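(* Let $\sigma\in\{213,312,231,132\}$. For every $n\ge2$ and every $k$ with $0\le k\le n-2$, the number of words $w\in\mathcal{P}_{n-1}^2(\sigma)$ with $\mathrm{des}(w)=k$ equals $$\frac{2}{n+1}\binom{n+1}{k+2}\binom{n-2}{k}.$$
   Context: $\mathfrak{S}_n$ is the set of permutations of $[n]=\{1,\dots,n\}$; $\mathrm{FIX}(\pi)=\{i:\pi(i)=i\}$. A $2$-arrangement of $[n]$ is a pair $(\pi,\phi)$ with $\pi\in\mathfrak{S}_n$ and $\phi:\mathrm{FIX}(\pi)\to\{-1,-2\}$ arbitrary. Its permutation form is the word obtained from $\pi(1)\cdots\pi(n)$ by replacing $\pi(i)$ with $-1$ for each $i\in\mathrm{FIX}(\pi)$ with $\phi(i)=-1$, and then replacing every occurrence of the $j$-th smallest positive letter by $j$ for all $j$. $\mathcal{P}_n^2$ is the set of permutation forms of $2$-arrangements of $[n]$. For an integer word $w=w_1\cdots w_n$, $\mathrm{des}(w)=|\{i\in[n-1]:w_i>w_{i+1}\}|$; $\mathrm{red}(w)$ replaces every occurrence of the $j$-th smallest letter by $j$; $w$ avoids $\sigma\in\mathfrak{S}_3$ if there are no $i_1<i_2<i_3$ with $\mathrm{red}(w_{i_1}w_{i_2}w_{i_3})=\sigma$. $\mathcal{P}_n^2(\sigma)$ is the set of words in $\mathcal{P}_n^2$ avoiding $\sigma$. *)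

theory Defs
  imports Complex_Main "HOL-Library.FuncSet" "HOL-Combinatorics.Permutations"
begin

definition FIX :: "nat \<Rightarrow> (nat \<Rightarrow> nat) \<Rightarrow> nat set" where
  "FIX n \<pi> = {i \<in> {1..n}. \<pi> i = i}"

definition std_pos :: "int list \<Rightarrow> int list" where
  "std_pos w = map (\<lambda>x. if x > 0 then int (card {y \<in> set w. 0 < y \<and> y \<le> x}) else x) w"

text \<open>Permutation form of the 2-arrangement (pi, phi) of [n].\<close>
definition perm_form :: "nat \<Rightarrow> (nat \<Rightarrow> nat) \<Rightarrow> (nat \<Rightarrow> int) \<Rightarrow> int list" where
  "perm_form n \<pi> \<phi> =
     std_pos (map (\<lambda>i. if i \<in> FIX n \<pi> \<and> \<phi> i = -1 then -1 else int (\<pi> i)) [1..<n+1])"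

definition P2 :: "nat \<Rightarrow> int list set" where
  "P2 n = {perm_form n \<pi> \<phi> | \<pi> \<phi>. \<pi> permutes {1..n} \<and> \<phi> \<in> FIX n \<pi> \<rightarrow>\<^sub>E {-1, -2}}"

definition des :: "int list \<Rightarrow> nat" where
  "des w = card {i. i + 1 < length w \<and> w ! i > w ! (i + 1)}"

definition red :: "int list \<Rightarrow> int list" where
  "red w = map (\<lambda>x. int (card {y \<in> set w. y \<le> x})) w"

definition avoids :: "int list \<Rightarrow> int list \<Rightarrow> bool" where
  "avoids w \<sigma> \<longleftrightarrow> \<not> (\<exists>i1 i2 i3. i1 < i2 \<and> i2 < i3 \<and> i3 < length w \<and>
                         red [w ! i1, w ! i2, w ! i3] = \<sigma>)"

definition P2_avoid :: "nat \<Rightarrow> int list \<Rightarrow> int list set" where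
  "P2_avoid n \<sigma> = {w \<in> P2 n. avoids w \<sigma>}"

end

theory Submission
  imports Defs "HOL-Computational_Algebra.Formal_Power_Series"
begin

unbundle fps_syntax

text \<open>
  Write $x$ for length and $t$ for descents, and let $A$ and $F$ be the generating functions of the
  avoiding permutations and of all avoiding words. Permutations give $A = 1 + xA(1 + t(A-1))$,
  so $A$ is the Narayana series. For 213 and 312, splitting a word at its first smallest letter gives
  $F = A + x(1 + t(A-1))F$. For 231 and 132, splitting $w = u\,m\,v$ at the maximum forces
  one of the two sides to be all $-1$ or the other one to have no $-1$, which gives another linear
  equation for $F$. In all four cases the solution is $F = A^2$, and the quadratic equation of $A$
  expresses the coefficients of $A^2$ through Narayana numbers.

  The closed form of the Narayana numbers is checked without Lagrange inversion: with
  $S = 1 - x(1-t) - 2xtA$ and $D = 1 - 2(1+t)x + (1-t)^2x^2$, their three-term recurrence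
  says $2DS' = D'S$, so that $S^2 = D$, which is the quadratic equation.
\<close>

section \<open>The Narayana generating function\<close>

text \<open>The set \<open>P2 n\<close> turns out to be all words of length n whose positive letters
  are 1..m, each once, for some m, and whose other letters are -1. The combinatorics therefore never
  looks at permutations with coloured fixed points; these return only in \<open>P2_eq\<close>.

  Reversal exchanges 213 with 312 and 231 with 132, but it turns descents into ascents, and because
  of repeated -1 (plateaus) the number of ascents is not determined by length and descents. So the
  patterns are not reduced to each other by symmetry: there are four parallel decompositions.

  The factor 1 + t(A-1) is A with one extra descent on nonempty words: an inserted maximum or first
  smallest letter creates a descent on one side exactly if the factor on that side is nonempty.

  The identity F = A^2 comes from no product decomposition of the words. Each family gives an
  equation linear in F, A^2 satisfies it too, and the coefficient of F has constant term 1, so it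
  cancels in the domain of power series.\<close>

text \<open>This is the Narayana number indexed from k = 0, so that k counts descents. The value at
  n = 0 is set by hand for the empty word.\<close>

definition narayana :: "nat \<Rightarrow> nat \<Rightarrow> real" where
  "narayana n k = (if n = 0 then of_bool (k = 0) else real (n choose k) * real (n choose Suc k) / real n)"

text \<open>The outer variable \<open>fps_X\<close> of \<open>real fps fps\<close> marks length, the inner one (\<open>tt\<close>) marks descents.\<close>

definition tt :: "real fps fps" where "tt = fps_const fps_X"

definition narayana_fps :: "real fps fps" where
  "narayana_fps = Abs_fps (\<lambda>n. Abs_fps (narayana n))"

section \<open>Three-term recurrence of the Narayana polynomials\<close>

lemma choose_Suc_real: "real (n choose Suc k) = real (n choose k) * (real n - real k) / (real k + 1)"
proof (cases "k \<le> n")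
  case True
  have "Suc k * (n choose Suc k) = (n - k) * (n choose k)"
    using binomial_absorb_comp binomial_absorption by (metis Suc_times_binomial_eq binomial_absorb_comp mult.commute)
  then have "real (Suc k) * real (n choose Suc k) = real (n - k) * real (n choose k)"
    by (metis of_nat_mult)
  then show ?thesis using True by (simp add: field_simps of_nat_diff)
next
  case False then show ?thesis by (simp add: binomial_eq_0)
qed

text \<open>In this form the quotient disappears and n = 0 needs no separate case: both sides vanish
  there.\<close>

lemma mult_narayana: "real n * narayana n k = real (n choose k) * real (n choose Suc k)"
  by (simp add: narayana_def)

lemma narayana_rec_Suc_Suc:
  "(real n + 3) * narayana (n + 2) (k + 2) = (2 * real n + 3) * (narayana (n + 1) (k + 2) + narayana (n + 1) (k + 1))
     - real n * (narayana n (k + 2) - 2 * narayana n (k + 1) + narayana n k)"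
proof -
  \<comment> \<open>Every binomial in the claim becomes b times a rational function of n and k,
    those in n+1 and n+2 through Pascal's rule. What remains is a rational identity.\<close>
  define b where "b = real (n choose k)"
  have b1: "real (n choose Suc k) = b * (real n - real k) / (real k + 1)"
    unfolding b_def by (rule choose_Suc_real)
  have b2: "real (n choose Suc (Suc k)) = b * (real n - real k) * (real n - real k - 1) / ((real k + 1) * (real k + 2))"
    by (subst choose_Suc_real) (simp add: b1 field_simps)
  have b3: "real (n choose Suc (Suc (Suc k))) = b * (real n - real k) * (real n - real k - 1) * (real n - real k - 2) / ((real k + 1) * (real k + 2) * (real k + 3))"
    by (subst choose_Suc_real) (simp add: b2 field_simps)
  have pos: "real n + 1 \<noteq> 0" "real n + 2 \<noteq> 0" "real k + 1 \<noteq> 0" "real k + 2 \<noteq> 0" "real k + 3 \<noteq> 0"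
    by linarith+
  have n0: "narayana (n + 1) j = real (Suc n choose j) * real (Suc n choose Suc j) / (real n + 1)"
       "narayana (n + 2) j = real (Suc (Suc n) choose j) * real (Suc (Suc n) choose Suc j) / (real n + 2)" for j
    by (simp_all add: narayana_def add.commute)
  show ?thesis
    unfolding right_diff_distrib distrib_left[of "real n"] mult.left_commute[of "real n"] mult_narayana n0
    apply (simp add: b1 b2 b3 b_def[symmetric] pos)
    using pos apply (simp add: divide_simps)
    apply algebra
    done
qed

lemma narayana_rec_1:
  "(real n + 3) * narayana (n + 2) 1 = (2 * real n + 3) * (narayana (n + 1) 1 + narayana (n + 1) 0)
     - real n * (narayana n 1 - 2 * narayana n 0)"
proof (cases "n = 0")
  case True then show ?thesis by (simp add: narayana_def)
next
  case False
  have c: "real (m choose Suc (Suc 0)) = real m * (real m - 1) / 2" for m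
    by (subst choose_Suc_real) simp
  show ?thesis using False
    unfolding narayana_def by (simp add: c divide_simps) algebra
qed

lemma narayana_rec_0:
  "(real n + 3) * narayana (n + 2) 0 = (2 * real n + 3) * narayana (n + 1) 0 - real n * narayana n 0"
  by (cases "n = 0") (simp_all add: narayana_def)

lemma narayana_fps_rec:
  "(of_nat n + 3) * narayana_fps $ (n + 2) = (2 * of_nat n + 3) * (1 + fps_X) * narayana_fps $ (n + 1)
     - of_nat n * (1 - fps_X)\<^sup>2 * narayana_fps $ n"
proof (rule fps_ext)
  fix k :: nat
  have "(1 - fps_X)\<^sup>2 * f = f - 2 * (fps_X * f) + fps_X * (fps_X * f)" for f :: "real fps"
    by (simp add: power2_eq_square algebra_simps)
  then have e: "(1 - fps_X)\<^sup>2 * f = f - fps_const 2 * (fps_X * f) + fps_X * (fps_X * f)" for f :: "real fps"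
    by (simp only: numeral_fps_const)
  have e': "(1 + fps_X) * f = f + fps_X * f" for f :: "real fps"
    by (simp add: algebra_simps)
  have c: "(of_nat n + 3 :: real fps) = fps_const (real n + 3)" "(2 * of_nat n + 3 :: real fps) = fps_const (2 * real n + 3)"
     "(of_nat n :: real fps) = fps_const (real n)"
    by (simp_all add: fps_of_nat[symmetric] numeral_fps_const fps_const_add[symmetric] fps_const_mult[symmetric] del: fps_const_add fps_const_mult)
  \<comment> \<open>The factor \<open>(1 - fps_X)\<^sup>2\<close> reaches back two coefficients, so
    the first two need their own recurrences.\<close>
  consider "k = 0" | "k = 1" | j where "k = j + 2" by (metis One_nat_def add_2_eq_Suc' not0_implies_Suc)
  then show "((of_nat n + 3) * narayana_fps $ (n + 2)) $ k = ((2 * of_nat n + 3) * (1 + fps_X) * narayana_fps $ (n + 1)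
     - of_nat n * (1 - fps_X)\<^sup>2 * narayana_fps $ n) $ k"
    unfolding c(1,2) unfolding c(3) mult.assoc e e' fps_sub_nth fps_add_nth fps_mult_left_const_nth fps_X_mult_nth
    by cases (use narayana_rec_0[of n] narayana_rec_1[of n] narayana_rec_Suc_Suc[of n "k - 2"] in
       \<open>simp_all add: narayana_fps_def\<close>)
qed

section \<open>From the recurrence to the quadratic equation\<close>

text \<open>Equal logarithmic derivatives and equal nonzero constant terms. The difference h
  satisfies h'g = hg'; if its lowest term had degree s > 0, the left side would have the coefficient
  s h_s g_0 at degree s-1, where the right side has 0.\<close>

lemma fps_eq_of_log_deriv_eq:
  fixes f g :: "'a::{idom,ring_char_0} fps"
  assumes "fps_deriv f * g = f * fps_deriv g" "f $ 0 = g $ 0" "g $ 0 \<noteq> 0"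
  shows "f = g"
proof (rule ccontr)
  define h where "h = f - g"
  assume "f \<noteq> g"
  then have h: "h \<noteq> 0" "h $ 0 = 0" using assms(2) by (auto simp: h_def)
  define s where "s = subdegree h"
  have s: "h $ s \<noteq> 0" "\<And>i. i < s \<Longrightarrow> h $ i = 0" using h by (auto simp: s_def)
  then obtain r where r: "s = Suc r" using h(2) by (cases s) auto
  have "fps_deriv h * g = h * fps_deriv g" using assms(1) by (simp add: h_def algebra_simps)
  then have "(fps_deriv h * g) $ r = (h * fps_deriv g) $ r" by simp
  moreover have "(h * fps_deriv g) $ r = 0" unfolding fps_mult_nth by (rule sum.neutral) (use s r in auto)
  moreover have "(fps_deriv h * g) $ r = (\<Sum>i=0..r. if i = r then of_nat (Suc r) * h $ Suc r * g $ 0 else 0)"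
    unfolding fps_mult_nth by (rule sum.cong) (use s r in auto)
  ultimately show False using s r assms(3) by (simp del: of_nat_Suc)
qed

text \<open>The criterion above is applied to series with coefficients in \<open>real fps\<close>,
  which must have characteristic 0.\<close>

instance fps :: (ring_char_0) ring_char_0 ..

lemma tt_nth [simp]: "(tt * f) $ n = fps_X * f $ n"
  by (simp add: tt_def)

lemma tt_nth_0 [simp]: "tt $ 0 = fps_X" "tt $ Suc n = 0"
  by (simp_all add: tt_def)

lemma narayana_fps_0 [simp]: "narayana_fps $ 0 = 1"
  by (rule fps_ext) (simp add: narayana_fps_def narayana_def)

lemma narayana_fps_1 [simp]: "narayana_fps $ Suc 0 = 1"
  by (rule fps_ext) (auto simp: narayana_fps_def narayana_def binomial_eq_0)

lemma narayana_fps_2 [simp]: "narayana_fps $ Suc (Suc 0) = 1 + fps_X"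
proof (rule fps_ext)
  fix k :: nat
  show "narayana_fps $ Suc (Suc 0) $ k = (1 + fps_X) $ k"
  by (cases k; cases "k - 1") (auto simp: narayana_fps_def narayana_def binomial_eq_0 numeral_2_eq_2)
qed

lemma narayana_fps_quadratic: "narayana_fps = 1 + fps_X * (1 - tt) * narayana_fps + fps_X * tt * narayana_fps\<^sup>2"
proof -
  \<comment> \<open>D is the discriminant of the quadratic equation as a polynomial in the unknown
    series, and S is the square root that its solution would produce.\<close>
  define S where "S = 1 - fps_X * (1 - tt) - 2 * fps_X * tt * narayana_fps"
  define D where "D = 1 - 2 * (1 + tt) * fps_X + (1 - tt)\<^sup>2 * fps_X\<^sup>2"
  have D': "fps_deriv D = 2 * ((1 - tt)\<^sup>2 * fps_X) - 2 * (1 + tt)"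
  proof -
    have dt: "fps_deriv tt = 0" by (simp add: tt_def)
    show ?thesis by (simp add: D_def dt power2_eq_square algebra_simps)
  qed
  define T where "T = fps_deriv S"
  \<comment> \<open>This is 2DS' = D'S multiplied out, with \<open>fps_X\<close> and
    \<open>tt\<close> arranged so that each summand has a readable coefficient.\<close>
  have "2 * T - 4 * ((1 + tt) * (fps_X * T)) + 2 * ((1 - tt)\<^sup>2 * (fps_X * (fps_X * T)))
     = 2 * ((1 - tt)\<^sup>2 * (fps_X * S)) - 2 * ((1 + tt) * S)"
  proof (rule fps_ext)
    fix n
    show "(2 * T - 4 * ((1 + tt) * (fps_X * T)) + 2 * ((1 - tt)\<^sup>2 * (fps_X * (fps_X * T)))) $ n
     = (2 * ((1 - tt)\<^sup>2 * (fps_X * S)) - 2 * ((1 + tt) * S)) $ n"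
    proof -
      have num: "(numeral k * f) $ n = numeral k * f $ n" for k n and f :: "real fps fps"
        by (simp add: numeral_fps_const)
      have num0: "(numeral k :: real fps fps) $ Suc n = 0" for k n
        by (simp add: numeral_fps_const)
      have t1: "((1 + tt) * f) $ n = (1 + fps_X) * f $ n" for n and f :: "real fps fps"
        by (simp add: algebra_simps)
      have t2: "((1 - tt)\<^sup>2 * f) $ n = (1 - fps_X)\<^sup>2 * f $ n" for n and f :: "real fps fps"
      proof -
        have "1 - tt = fps_const (1 - fps_X)" by (rule fps_ext) (simp add: tt_def)
        then show ?thesis unfolding power2_eq_square by (simp only: fps_const_mult fps_mult_left_const_nth)
      qed
      have S0: "S $ 0 = 1" and S1: "S $ Suc 0 = - (1 + fps_X)"
        by (simp_all add: S_def mult.assoc num)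
      have SS: "S $ Suc (Suc n) = - 2 * fps_X * narayana_fps $ Suc n" for n
        by (simp add: S_def mult.assoc num)
      have T: "T $ n = of_nat (n + 1) * S $ Suc n" for n by (simp add: T_def)
      \<comment> \<open>From index 2 on, the coefficients of S are -2t times Narayana polynomials,
        but \<open>S0\<close> and \<open>S1\<close> are irregular and enter up to n = 2. For n = m +
        3 the equation is the recurrence at m + 1.\<close>
      consider "n = 0" | "n = 1" | "n = 2" | m where "n = m + 3"
        by (cases "n \<ge> 3") (fastforce simp: le_iff_add add.commute)+
      then show ?thesis
      proof cases
        case 4
        have aux: "8 * ((1 + x) * ((3 + l) * (x * h))) - 4 * ((4 + l) * (x * i)) - 4 * ((1 - x)\<^sup>2 * ((2 + l) * (x * g)))
            = 4 * ((1 + x) * (x * h)) - 4 * ((1 - x)\<^sup>2 * (x * g))"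
          if "(4 + l) * i = (5 + 2 * l) * (1 + x) * h - (1 + l) * (1 - x)\<^sup>2 * g" for x l g h i :: "real fps"
        proof -
          have "4 * ((4 + l) * (x * i)) = 4 * (x * ((4 + l) * i))" by (simp only: mult.left_commute)
          then show ?thesis unfolding that by (simp add: algebra_simps power2_eq_square)
        qed
        show ?thesis using 4 narayana_fps_rec[of "m + 1"]
          by (simp add: num t1 t2 T SS numeral_3_eq_3) (rule aux, assumption)
      qed (simp_all add: num t1 t2 T S0 S1 SS eval_nat_numeral, simp_all add: num num0 T S0 S1 algebra_simps power2_eq_square)
    qed
  qed
  then have "2 * (D * T) = fps_deriv D * S"
    unfolding D' unfolding D_def by (simp add: power2_eq_square algebra_simps)
  then have "2 * (D * fps_deriv S) = fps_deriv D * S" by (simp add: T_def)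
  then have "fps_deriv (S\<^sup>2) * D = S\<^sup>2 * fps_deriv D"
    by (simp add: power2_eq_square algebra_simps)
  then have "S\<^sup>2 = D"
    by (rule fps_eq_of_log_deriv_eq) (simp_all add: S_def D_def tt_def power2_eq_square)
  \<comment> \<open>S^2 - D is 4xt times the difference of the two sides of the quadratic equation,
    and 4xt cancels in the domain.\<close>
  then have "4 * (fps_X * tt) * narayana_fps = 4 * (fps_X * tt) * (1 + fps_X * (1 - tt) * narayana_fps + fps_X * tt * narayana_fps\<^sup>2)"
    unfolding S_def D_def by algebra
  moreover have "4 * (fps_X * tt) \<noteq> 0" by (simp add: tt_def)
  ultimately show ?thesis by (simp add: right_minus_eq)
qed

text \<open>In the quadratic equation the square carries the factor xt, so the coefficient of
  x^(m+2) t^(k+1) isolates the wanted one as a combination of three Narayana numbers.\<close>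

lemma narayana_fps_sq_nth:
  "(narayana_fps\<^sup>2) $ Suc m $ k = 2 / (real m + 3) * real ((m + 3) choose (k + 2)) * real (m choose k)"
proof -
  have "narayana_fps $ Suc (Suc m) = (1 + fps_X * (1 - tt) * narayana_fps + fps_X * tt * narayana_fps\<^sup>2) $ Suc (Suc m)"
    using narayana_fps_quadratic by simp
  also have "\<dots> = narayana_fps $ Suc m - fps_X * narayana_fps $ Suc m + fps_X * (narayana_fps\<^sup>2) $ Suc m"
    by (simp add: mult.assoc left_diff_distrib)
  finally have "narayana_fps $ Suc (Suc m) $ Suc k = (narayana_fps $ Suc m - fps_X * narayana_fps $ Suc m + fps_X * (narayana_fps\<^sup>2) $ Suc m) $ Suc k"
    by simp
  then have eq: "(narayana_fps\<^sup>2) $ Suc m $ k = narayana (Suc (Suc m)) (Suc k) - narayana (Suc m) (Suc k) + narayana (Suc m) k"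
    by (simp add: narayana_fps_def)
  show ?thesis
  proof (cases k)
    case 0
    have c: "real (m choose Suc (Suc 0)) = real m * (real m - 1) / 2" for m
      by (subst choose_Suc_real) simp
    show ?thesis unfolding eq unfolding 0 by (simp add: narayana_def c numeral_2_eq_2 numeral_3_eq_3 divide_simps) algebra
  next
    case (Suc j)
    define x y where "x = real m" and "y = real j"
    have pos: "x + 1 \<noteq> 0" "x + 2 \<noteq> 0" "x + 3 \<noteq> 0" "y + 1 \<noteq> 0" "y + 2 \<noteq> 0" "y + 3 \<noteq> 0"
      unfolding x_def y_def by linarith+
    \<comment> \<open>With k = j + 1, dividing by y + 1 in advance makes all binomials below
      multiples of p whose only denominators are y + 2 and y + 3.\<close>
    define p where "p = real (m choose j) / (y + 1)"
    have absorb: "real (Suc n choose Suc l) = real (n choose l) * (real n + 1) / (real l + 1)" for n l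
      using Suc_times_binomial_eq[of n l, THEN arg_cong[of _ _ real]] by (simp add: field_simps)
    have c0: "real (m choose Suc j) = p * (x - y)"
      by (subst choose_Suc_real) (simp add: p_def x_def y_def del: binomial_Suc_Suc)
    have c1: "real (Suc m choose Suc j) = p * (x + 1)"
      by (subst absorb) (simp add: p_def x_def y_def del: binomial_Suc_Suc)
    have c1': "real (Suc m choose Suc (Suc j)) = p * (x + 1) * (x - y) / (y + 2)"
      by (subst choose_Suc_real) (simp add: c1 x_def y_def add.commute del: binomial_Suc_Suc)
    have c1'': "real (Suc m choose Suc (Suc (Suc j))) = p * (x + 1) * (x - y) * (x - y - 1) / ((y + 2) * (y + 3))"
      by (subst choose_Suc_real) (simp add: c1' x_def y_def add.commute del: binomial_Suc_Suc)
    have c2: "real (Suc (Suc m) choose Suc (Suc j)) = p * (x + 1) * (x + 2) / (y + 2)"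
      by (subst absorb) (simp add: c1 x_def y_def add.commute del: binomial_Suc_Suc)
    have c2': "real (Suc (Suc m) choose Suc (Suc (Suc j))) = p * (x + 1) * (x + 2) * (x - y) / ((y + 2) * (y + 3))"
      by (subst choose_Suc_real) (simp add: c2 x_def y_def add.commute del: binomial_Suc_Suc)
    have c3: "real (m + 3 choose (k + 2)) = p * (x + 1) * (x + 2) * (x + 3) / ((y + 2) * (y + 3))"
    proof -
      have "m + 3 = Suc (Suc (Suc m))" "k + 2 = Suc (Suc (Suc j))" using Suc by simp_all
      then show ?thesis by (simp only:) (subst absorb, simp add: c2 x_def y_def add.commute del: binomial_Suc_Suc)
    qed
    \<comment> \<open>The common factor of the three Narayana numbers and of the closed form.
      Without it the claim is (x+1)(x+2) - (x-y)(x-y-1) + (y+2)(y+3) = 2(x+2)(y+2).\<close>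
    define r where "r = p\<^sup>2 * (x + 1) * (x - y) / ((y + 2)\<^sup>2 * (y + 3))"
    have rx: "real (Suc m) = x + 1" "real (Suc (Suc m)) = x + 2" by (simp_all add: x_def)
    have n1: "narayana (Suc (Suc m)) (Suc (Suc j)) = r * ((x + 1) * (x + 2))"
      unfolding narayana_def c2 c2' r_def rx using pos by (simp add: divide_simps power2_eq_square)
    have n2: "narayana (Suc m) (Suc (Suc j)) = r * ((x - y) * (x - y - 1))"
      unfolding narayana_def c1' c1'' r_def rx using pos by (simp add: divide_simps power2_eq_square)
    have n3: "narayana (Suc m) (Suc j) = r * ((y + 2) * (y + 3))"
      unfolding narayana_def c1 c1' r_def rx using pos by (simp add: divide_simps power2_eq_square)
    have "2 / (real m + 3) * real ((m + 3) choose (k + 2)) * real (m choose k) = r * (2 * (x + 2) * (y + 2))"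
      unfolding c3 unfolding Suc c0 r_def x_def[symmetric] using pos by (simp add: divide_simps power2_eq_square)
    moreover have "(narayana_fps\<^sup>2) $ Suc m $ k = r * ((x + 1) * (x + 2)) - r * ((x - y) * (x - y - 1)) + r * ((y + 2) * (y + 3))"
      unfolding eq unfolding Suc n1 n2 n3 ..
    ultimately show ?thesis by algebra
  qed
qed

text \<open>Subtracting the two quadratic equations leaves the difference of the solutions times a
  series with constant term 1, which cannot be zero.\<close>

lemma narayana_fps_unique:
  assumes "A = 1 + fps_X * A * (1 + tt * (A - 1))"
  shows "A = narayana_fps"
proof -
  have "(A - narayana_fps) * (1 - fps_X * (1 - tt + tt * (A + narayana_fps))) = 0"
    using assms narayana_fps_quadratic by algebra
  moreover have "1 - fps_X * (1 - tt + tt * (A + narayana_fps)) \<noteq> 0"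
  proof
    assume "1 - fps_X * (1 - tt + tt * (A + narayana_fps)) = 0"
    from arg_cong[OF this, of "\<lambda>f. f $ 0"] show False by simp
  qed
  ultimately show ?thesis by simp
qed

section \<open>Words, descents and pattern avoidance\<close>

text \<open>A pattern is a relation R on three letters, so order embeddings pass through it.
  Recursion on the word instead of on positions makes avoidance by a concatenation split as in
  \<open>av_append\<close>.\<close>

primrec av :: "('a \<Rightarrow> 'a \<Rightarrow> 'a \<Rightarrow> bool) \<Rightarrow> 'a list \<Rightarrow> bool" where
  "av R [] = True"
| "av R (a # w) = (av R w \<and> sorted_wrt (\<lambda>b c. \<not> R a b c) w)"

lemma av_append:
  "av R (u @ v) \<longleftrightarrow> av R u \<and> av R v \<and> (\<forall>a\<in>set u. sorted_wrt (\<lambda>b c. \<not> R a b c) v)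
     \<and> (\<forall>c\<in>set v. sorted_wrt (\<lambda>a b. \<not> R a b c) u)"
  by (induction u) (auto simp: sorted_wrt_append)

lemma av_map: "av R (map f w) = av (\<lambda>a b c. R (f a) (f b) (f c)) w"
  by (induction w) (auto simp: sorted_wrt_map)

lemma av_iff_nth:
  "av R w \<longleftrightarrow> (\<forall>i j k. i < j \<longrightarrow> j < k \<longrightarrow> k < length w \<longrightarrow> \<not> R (w ! i) (w ! j) (w ! k))"
proof (induction w)
  case (Cons a w)
  show ?case
    unfolding av.simps Cons.IH sorted_wrt_iff_nth_less
    apply (rule iffI)
     apply (intro allI impI)
    subgoal for i j k by (cases i; cases j; cases k) auto
    apply (intro conjI allI impI)
    subgoal for i j k by (drule spec[of _ "Suc i"], drule spec[of _ "Suc j"], drule spec[of _ "Suc k"]) simp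
    subgoal for i j by (drule spec[of _ 0], drule spec[of _ "Suc i"], drule spec[of _ "Suc j"]) simp
    done
qed simp

fun dsc :: "'a::linorder list \<Rightarrow> nat" where
  "dsc (a # b # w) = of_bool (b < a) + dsc (b # w)"
| "dsc w = 0"

lemma dsc_append:
  "dsc (u @ v) = dsc u + dsc v + of_bool (u \<noteq> [] \<and> v \<noteq> [] \<and> hd v < last u)"
proof (induction u rule: dsc.induct)
  case "2_1"
  then show ?case by simp
next
  case (1 a b w)
  then show ?case by simp
next
  case ("2_2" a)
  then show ?case by (cases v) auto
qed

lemma dsc_map: "strict_mono f \<Longrightarrow> dsc (map f w) = dsc w"
  by (induction w rule: dsc.induct) (auto simp: strict_mono_less)

lemma card_descents: "card {i. i + 1 < length w \<and> w ! i > w ! (i + 1)} = dsc w"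
proof (induction w rule: dsc.induct)
  case (1 a b w)
  have "{i. i + 1 < length (a # b # w) \<and> (a # b # w) ! i > (a # b # w) ! (i + 1)}
     = {i. i = 0 \<and> b < a} \<union> Suc ` {i. i + 1 < length (b # w) \<and> (b # w) ! i > (b # w) ! (i + 1)}"
    apply (rule set_eqI) subgoal for i by (cases i) auto done
  then show ?case
    using 1 by (simp only:) (subst card_Un_disjoint, auto simp: card_image)
qed auto

text \<open>In \<open>nat list\<close>, the letter $0$ stands for $-1$.\<close>

definition valid :: "nat list set" where
  "valid = {w. distinct (filter ((\<noteq>) 0) w) \<and> (\<exists>m. set w - {0} = {1..m})}"

definition npos :: "nat list \<Rightarrow> nat" where "npos w = card (set w - {0})"

text \<open>The letter 0 stays fixed because it encodes -1, which is the same smallest letter in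
  every factor of a word.\<close>

definition shift :: "nat \<Rightarrow> nat \<Rightarrow> nat" where "shift k x = (if x = 0 then 0 else x + k)"

lemma valid_altdef: "w \<in> valid \<longleftrightarrow> distinct (filter ((\<noteq>) 0) w) \<and> set w - {0} = {1..npos w}"
proof -
  have "(\<exists>m. set w - {0} = {1..m}) \<longleftrightarrow> set w - {0} = {1..npos w}"
    unfolding npos_def by (metis card_atLeastAtMost diff_Suc_1)
  then show ?thesis by (simp add: valid_def)
qed

lemma strict_mono_shift: "strict_mono (shift k)"
  by (auto simp: strict_mono_def shift_def)

section \<open>Valid words under concatenation and insertion\<close>

lemma valid_append_comm: "u @ v \<in> valid \<longleftrightarrow> v @ u \<in> valid"
  by (auto simp: valid_def Un_commute)

lemma npos_append_comm: "npos (u @ v) = npos (v @ u)"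
  by (simp add: npos_def Un_commute)

lemma valid_append_shift:
  assumes "u \<in> valid" "v \<in> valid"
  shows "u @ map (shift (npos u)) v \<in> valid" "npos (u @ map (shift (npos u)) v) = npos u + npos v"
proof -
  let ?k = "npos u"
  have u: "distinct (filter ((\<noteq>) 0) u)" "set u - {0} = {1..?k}"
    and v: "distinct (filter ((\<noteq>) 0) v)" "set v - {0} = {1..npos v}"
    using assms by (auto simp: valid_altdef)
  have im: "set (map (shift ?k) v) - {0} = {?k+1..?k+npos v}"
  proof -
    have "set (map (shift ?k) v) - {0} = (\<lambda>x. x + ?k) ` (set v - {0})"
      by (auto simp: shift_def image_iff split: if_splits)
    then show ?thesis unfolding v by (simp add: add.commute)
  qed
  have f: "filter ((\<noteq>) 0) (map (shift ?k) v) = map (shift ?k) (filter ((\<noteq>) 0) v)"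
    by (induction v) (auto simp: shift_def)
  have d: "distinct (filter ((\<noteq>) 0) (map (shift ?k) v))"
    unfolding f distinct_map using v(1) strict_mono_shift strict_mono_imp_inj_on by (metis inj_on_subset subset_UNIV)
  have un: "set (u @ map (shift ?k) v) - {0} = {1..?k+npos v}"
    unfolding set_append Un_Diff u im by auto
  then show "npos (u @ map (shift (npos u)) v) = npos u + npos v" by (simp add: npos_def)
  have disj: "(set u - {0}) \<inter> (set (map (shift ?k) v) - {0}) = {}" unfolding u im by auto
  have "distinct (filter ((\<noteq>) 0) (u @ map (shift ?k) v))"
    using d u(1) disj by (simp del: set_map) blast
  then show "u @ map (shift (npos u)) v \<in> valid" using un by (auto simp: valid_def)
qed

text \<open>Converse of \<open>valid_append_shift\<close>. A positive letter below the maximum of p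
  cannot lie in q, so the positive letters of p fill an initial interval, and those of q the rest of
  1..m.\<close>

lemma valid_appendE:
  assumes "p @ q \<in> valid" "\<And>a c. a \<in> set p \<Longrightarrow> c \<in> set q \<Longrightarrow> 0 < a \<Longrightarrow> 0 < c \<Longrightarrow> a < c"
  obtains v where "p \<in> valid" "v \<in> valid" "q = map (shift (npos p)) v"
proof -
  let ?A = "set p - {0}" and ?B = "set q - {0}"
  define k where "k = npos p"
  have d: "distinct (filter ((\<noteq>) 0) p)" "distinct (filter ((\<noteq>) 0) q)" "?A \<inter> ?B = {}"
    using assms(1) by (auto simp: valid_def)
  obtain m where m: "?A \<union> ?B = {1..m}" using assms(1) by (auto simp: valid_def)
  have less: "a < c" if "a \<in> ?A" "c \<in> ?B" for a c using that assms(2) by auto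
  have "?A = {1..k}"
  proof (cases "?A = {}")
    case True then show ?thesis by (simp add: k_def npos_def)
  next
    case False
    define M where "M = Max ?A"
    have M: "M \<in> ?A" "\<And>a. a \<in> ?A \<Longrightarrow> a \<le> M" using False unfolding M_def by (intro Max_in Max_ge; simp)+
    have "?A = {1..M}"
    proof (intro equalityI subsetI)
      fix a assume "a \<in> {1..M}"
      moreover from M m have "M \<le> m" by (metis UnI1 atLeastAtMost_iff)
      ultimately have "a \<in> ?A \<union> ?B" unfolding m by auto
      moreover have "a \<notin> ?B" using less[OF M(1)] \<open>a \<in> {1..M}\<close> by force
      ultimately show "a \<in> ?A" by blast
    qed (use M(2) in \<open>auto simp: Suc_le_eq\<close>)
    then show ?thesis by (metis card_atLeastAtMost diff_Suc_1 k_def npos_def One_nat_def)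
  qed
  note A = this
  have B: "?B = {k+1..m}"
  proof -
    have "?B = {1..m} - {1..k}" using m d(3) A by blast
    then show ?thesis by (simp add: set_eq_iff) linarith
  qed
  let ?g = "\<lambda>x. x - k"
  define v where "v = map ?g q"
  have q0: "x = 0 \<or> k < x" if "x \<in> set q" for x using B that by (metis DiffI Suc_eq_plus1 Suc_le_eq atLeastAtMost_iff singletonD)
  have "q = map (shift k) v"
    unfolding v_def map_map by (rule map_idI[symmetric]) (drule q0, auto simp: shift_def)
  moreover have "v \<in> valid"
  proof -
    have qk: "x - k \<noteq> 0 \<longleftrightarrow> x \<noteq> 0" if "x \<in> set q" for x using q0[OF that] by auto
    have "set v - {0} = ?g ` ?B"
    proof (intro equalityI subsetI)
      fix y assume "y \<in> set v - {0}"
      then obtain x where x: "x \<in> set q" "y = x - k" "y \<noteq> 0" by (auto simp: v_def)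
      then show "y \<in> ?g ` ?B" using qk[of x] by (intro image_eqI[of _ _ x]) simp_all
    next
      fix y assume "y \<in> ?g ` ?B"
      then obtain x where x: "x \<in> set q" "y = x - k" "x \<noteq> 0" by blast
      then show "y \<in> set v - {0}" using qk[of x] by (simp add: v_def)
    qed
    also have "\<dots> = {1..m-k}" unfolding B
    proof (intro equalityI subsetI)
      fix x assume "x \<in> {1..m-k}" then show "x \<in> ?g ` {k+1..m}" by (intro image_eqI[of _ _ "x+k"]) auto
    qed auto
    finally have s: "set v - {0} = {1..m-k}" .
    have "filter ((\<noteq>) 0) v = map ?g (filter ((\<noteq>) 0) q)"
      unfolding v_def filter_map o_def
      by (rule arg_cong[where f = "map ?g"], rule filter_cong[OF refl]) (use qk in auto)
    moreover have "inj_on ?g (set (filter ((\<noteq>) 0) q))"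
    proof (rule inj_onI)
      fix x y assume "x \<in> set (filter ((\<noteq>) 0) q)" "y \<in> set (filter ((\<noteq>) 0) q)" "x - k = y - k"
      then show "x = y" using q0[of x] q0[of y] by auto
    qed
    ultimately have "distinct (filter ((\<noteq>) 0) v)" using d(2) by (simp add: distinct_map)
    then show ?thesis using s by (auto simp: valid_def)
  qed
  moreover have "p \<in> valid" using A d(1) by (auto simp: valid_def)
  ultimately show thesis using that unfolding k_def by blast
qed

lemma valid_insert_0: "p @ 0 # q \<in> valid \<longleftrightarrow> p @ q \<in> valid" "npos (p @ 0 # q) = npos (p @ q)"
  by (auto simp: valid_def npos_def)

lemma valid_insert_max:
  assumes "p @ q \<in> valid" shows "p @ Suc (npos (p @ q)) # q \<in> valid"
    "npos (p @ Suc (npos (p @ q)) # q) = Suc (npos (p @ q))"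
proof -
  let ?m = "npos (p @ q)"
  have w: "distinct (filter ((\<noteq>) 0) (p @ q))" "set (p @ q) - {0} = {1..?m}"
    using assms by (auto simp: valid_altdef)
  have notin: "Suc ?m \<notin> set (p @ q)" using w(2) by (metis DiffI Suc_n_not_le_n atLeastAtMost_iff nat.distinct(1) singletonD)
  have s: "set (p @ Suc ?m # q) - {0} = {1..Suc ?m}"
  proof -
    have "set (p @ Suc ?m # q) - {0} = insert (Suc ?m) (set (p @ q) - {0})" by auto
    moreover have "insert (Suc m) {1..m} = {1..Suc m}" for m :: nat by auto
    ultimately show ?thesis unfolding w(2) by simp
  qed
  then show "npos (p @ Suc ?m # q) = Suc ?m" by (simp add: npos_def)
  show "p @ Suc ?m # q \<in> valid" unfolding valid_def using s w(1) notin by auto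
qed

lemma valid_maxE:
  assumes "w \<in> valid" "npos w \<noteq> 0"
  obtains p q where "w = p @ Suc (npos (p @ q)) # q" "p @ q \<in> valid" "\<forall>x\<in>set (p @ q). x < Suc (npos (p @ q))"
proof -
  define m where "m = npos w"
  have w: "distinct (filter ((\<noteq>) 0) w)" "set w - {0} = {1..m}"
    using assms by (auto simp: valid_altdef m_def)
  have "m \<in> set w" using w(2) assms(2) by (metis DiffD1 atLeastAtMost_iff le_refl m_def not_less_eq_eq One_nat_def le_0_eq)
  then obtain p q where pq: "w = p @ m # q" by (meson split_list)
  have m0: "m \<noteq> 0" using assms m_def by simp
  have notin: "m \<notin> set (p @ q)" using w(1) m0 by (auto simp: pq)
  have s: "set (p @ q) - {0} = {1..m-1}"
  proof -
    have "set (p @ q) - {0} = (set w - {0}) - {m}" using notin by (auto simp: pq)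
    moreover have "{1..m} - {m} = {1..m - 1}" by auto
    ultimately show ?thesis unfolding w(2) by simp
  qed
  then have n: "npos (p @ q) = m - 1" by (simp add: npos_def)
  have "distinct (filter ((\<noteq>) 0) (p @ q))" using w(1) m0 by (auto simp: pq)
  then have v: "p @ q \<in> valid" unfolding valid_def using s by blast
  have "\<forall>x\<in>set (p @ q). x < m"
  proof
    fix x assume "x \<in> set (p @ q)"
    then have "x = 0 \<or> x \<in> {1..m-1}" using s by blast
    then show "x < m" using m0 by (elim disjE) (simp, simp, linarith)
  qed
  moreover have "Suc (npos (p @ q)) = m" using n m0 by simp
  ultimately show thesis using that[of p q] pq v by (simp only:)
qed

lemma npos_le_length: "npos w \<le> length w"
  unfolding npos_def by (meson card_Diff1_le card_length le_trans)

lemma valid_le_npos: "w \<in> valid \<Longrightarrow> x \<in> set w \<Longrightarrow> x \<le> npos w"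
  by (metis Diff_iff atLeastAtMost_iff le0 singletonD valid_altdef)

lemma finite_valid: "finite {w \<in> valid. length w = n}"
proof (rule finite_subset)
  show "{w \<in> valid. length w = n} \<subseteq> {w. set w \<subseteq> {..n} \<and> length w = n}"
    using le_trans[OF valid_le_npos npos_le_length] by auto
qed (simp add: finite_lists_length_eq)

section \<open>Generating functions of families of words\<close>

text \<open>The statistic d is a parameter because the two factors of a decomposed word are weighted
  differently, one by \<open>dsc\<close> and one by \<open>aug\<close>. Sums over infinite sets
  would collapse to 0; this is why later lemmas assume families inside \<open>valid\<close>.\<close>

definition gf :: "('b list \<Rightarrow> nat) \<Rightarrow> 'b list set \<Rightarrow> real fps fps" where
  "gf d S = Abs_fps (\<lambda>n. \<Sum>w | w \<in> S \<and> length w = n. fps_X ^ d w)"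

text \<open>The extra 1 is the descent between a nonempty factor and the letter inserted next to
  it.\<close>

definition aug :: "nat list \<Rightarrow> nat" where
  "aug w = dsc w + of_bool (w \<noteq> [])"

lemma finite_words: "S \<subseteq> valid \<Longrightarrow> finite {w \<in> S. length w = n}"
  by (rule finite_subset[OF _ finite_valid[of n]]) auto

lemma gf_Un:
  assumes "S \<subseteq> valid" "T \<subseteq> valid" "S \<inter> T = {}"
  shows "gf d (S \<union> T) = gf d S + gf d T"
proof (rule fps_ext)
  fix n
  have "{w. w \<in> S \<union> T \<and> length w = n} = {w \<in> S. length w = n} \<union> {w \<in> T. length w = n}" by auto
  then show "gf d (S \<union> T) $ n = (gf d S + gf d T) $ n"
    using assms by (simp add: gf_def) (subst sum.union_disjoint, auto simp: finite_words)
qed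

lemma gf_Diff: "S \<subseteq> valid \<Longrightarrow> T \<subseteq> S \<Longrightarrow> gf d (S - T) = gf d S - gf d T"
  using gf_Un[of "S - T" T d] by (simp add: Un_absorb2 Diff_Int_distrib2 subset_trans[OF Diff_subset] subset_trans[of T S])

lemma gf_image:
  assumes "inj_on f S" "\<And>w. w \<in> S \<Longrightarrow> length (f w) = length w" "\<And>w. w \<in> S \<Longrightarrow> d (f w) = d w"
  shows "gf d (f ` S) = gf d S"
proof (rule fps_ext)
  fix n
  have "{w. w \<in> f ` S \<and> length w = n} = f ` {w \<in> S. length w = n}" using assms(2) by auto
  moreover have "inj_on f {w \<in> S. length w = n}" using assms(1) by (rule inj_on_subset) auto
  ultimately show "gf d (f ` S) $ n = gf d S $ n"
    using assms(3) by (simp add: gf_def sum.reindex)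
qed

text \<open>A Cauchy product graded by the length of u. The factor \<open>fps_X\<close> stands for
  the one letter that f inserts, and injectivity lets the sum run over pairs.\<close>

lemma gf_prod:
  assumes "S \<subseteq> valid" "T \<subseteq> valid" "inj_on f (S \<times> T)"
    "\<And>u v. u \<in> S \<Longrightarrow> v \<in> T \<Longrightarrow> length (f (u, v)) = Suc (length u + length v)"
    "\<And>u v. u \<in> S \<Longrightarrow> v \<in> T \<Longrightarrow> d (f (u, v)) = d1 u + d2 v"
  shows "gf d (f ` (S \<times> T)) = fps_X * (gf d1 S * gf d2 T)"
proof (rule fps_ext)
  fix n
  show "gf d (f ` (S \<times> T)) $ n = (fps_X * (gf d1 S * gf d2 T)) $ n"
  proof (cases n)
    case 0
    have "length (f p) \<noteq> 0" if "p \<in> S \<times> T" for p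
      using assms(4)[of "fst p" "snd p"] that by (simp add: mem_Times_iff)
    then have "{w. w \<in> f ` (S \<times> T) \<and> length w = n} = {}" unfolding 0 by blast
    then show ?thesis unfolding gf_def fps_nth_Abs_fps by (simp only: sum.empty 0) simp
  next
    case (Suc m)
    let ?S = "\<lambda>i. {w \<in> S. length w = i}" and ?T = "\<lambda>i. {w \<in> T. length w = i}"
    define I where "I = (\<Union>i\<in>{0..m}. ?S i \<times> ?T (m - i))"
    have eq: "{w. w \<in> f ` (S \<times> T) \<and> length w = n} = f ` I"
    proof (intro equalityI subsetI)
      fix w assume "w \<in> {w. w \<in> f ` (S \<times> T) \<and> length w = n}"
      then obtain u v where uv: "u \<in> S" "v \<in> T" "w = f (u, v)" "length w = n" by auto
      then have "length u + length v = m" using assms(4)[of u v] Suc by simp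
      then show "w \<in> f ` I" using uv by (intro image_eqI[of _ _ "(u, v)"]) (auto simp: I_def)
    next
      fix w assume "w \<in> f ` I"
      then show "w \<in> {w. w \<in> f ` (S \<times> T) \<and> length w = n}" using assms(4) Suc by (auto simp: I_def)
    qed
    have sub: "I \<subseteq> S \<times> T" by (auto simp: I_def)
    have "gf d (f ` (S \<times> T)) $ n = (\<Sum>w\<in>f ` I. fps_X ^ d w)" by (simp add: gf_def eq)
    also have "\<dots> = (\<Sum>p\<in>I. fps_X ^ d (f p))"
      by (subst sum.reindex) (auto intro: inj_on_subset[OF assms(3) sub])
    also have "\<dots> = (\<Sum>p\<in>I. fps_X ^ d1 (fst p) * fps_X ^ d2 (snd p))"
      by (rule sum.cong) (use sub assms(5) in \<open>auto simp: power_add subset_iff\<close>)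
    also have "\<dots> = (\<Sum>i=0..m. \<Sum>p\<in>?S i \<times> ?T (m - i). fps_X ^ d1 (fst p) * fps_X ^ d2 (snd p))"
      unfolding I_def by (rule sum.UNION_disjoint) (auto simp: finite_words assms)
    also have "\<dots> = (\<Sum>i=0..m. gf d1 S $ i * gf d2 T $ (m - i))"
      by (rule sum.cong) (simp_all add: gf_def sum_product sum.cartesian_product case_prod_beta)
    also have "\<dots> = (fps_X * (gf d1 S * gf d2 T)) $ n"
      by (simp add: Suc) (simp add: fps_mult_nth)
    finally show ?thesis .
  qed
qed

lemma gf_nth_0: "[] \<in> S \<Longrightarrow> d [] = 0 \<Longrightarrow> gf d S $ 0 = 1"
proof -
  assume "[] \<in> S" "d [] = 0"
  moreover from this have "{w. w \<in> S \<and> length w = 0} = {[]}" by auto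
  ultimately show ?thesis by (simp add: gf_def)
qed

lemma gf_aug:
  assumes "[] \<in> S" shows "gf aug S = 1 + tt * (gf dsc S - 1)"
proof (rule fps_ext)
  fix n
  show "gf aug S $ n = (1 + tt * (gf dsc S - 1)) $ n"
  proof (cases n)
    case 0 then show ?thesis using gf_nth_0[OF assms, of aug] gf_nth_0[OF assms, of dsc] by (simp add: aug_def)
  next
    case (Suc m)
    have "gf aug S $ n = (\<Sum>w | w \<in> S \<and> length w = n. fps_X * fps_X ^ dsc w)"
      unfolding gf_def fps_nth_Abs_fps by (rule sum.cong) (auto simp: aug_def Suc)
    then show ?thesis by (simp add: gf_def Suc sum_distrib_left)
  qed
qed

section \<open>The four patterns, and the effect of a maximum or a first zero\<close>

definition r213 :: "'a::linorder \<Rightarrow> 'a \<Rightarrow> 'a \<Rightarrow> bool" where "r213 a b c \<longleftrightarrow> b < a \<and> a < c"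
definition r312 :: "'a::linorder \<Rightarrow> 'a \<Rightarrow> 'a \<Rightarrow> bool" where "r312 a b c \<longleftrightarrow> b < c \<and> c < a"
definition r231 :: "'a::linorder \<Rightarrow> 'a \<Rightarrow> 'a \<Rightarrow> bool" where "r231 a b c \<longleftrightarrow> c < a \<and> a < b"
definition r132 :: "'a::linorder \<Rightarrow> 'a \<Rightarrow> 'a \<Rightarrow> bool" where "r132 a b c \<longleftrightarrow> a < c \<and> c < b"

lemmas r_defs = r213_def r312_def r231_def r132_def

lemma av_map_strict_mono:
  assumes "strict_mono f"
  shows "av r213 (map f w) = av r213 w" "av r312 (map f w) = av r312 w"
    "av r231 (map f w) = av r231 w" "av r132 (map f w) = av r132 w"
  unfolding av_map by (simp_all add: r_defs[abs_def] strict_mono_less[OF assms])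

definition words :: "(nat \<Rightarrow> nat \<Rightarrow> nat \<Rightarrow> bool) \<Rightarrow> nat list set" where
  "words R = {w \<in> valid. av R w}"

definition perms :: "(nat \<Rightarrow> nat \<Rightarrow> nat \<Rightarrow> bool) \<Rightarrow> nat list set" where
  "perms R = {w \<in> words R. 0 \<notin> set w}"

definition zeros :: "nat list set" where
  "zeros = range (\<lambda>n. replicate n 0)"

lemma zeros_iff: "w \<in> zeros \<longleftrightarrow> w \<in> valid \<and> npos w = 0"
proof
  assume "w \<in> zeros"
  then obtain n where "w = replicate n 0" by (auto simp: zeros_def)
  then show "w \<in> valid \<and> npos w = 0" by (auto simp: valid_def npos_def intro!: exI[of _ 0])
next
  assume "w \<in> valid \<and> npos w = 0"
  then have "set w - {0} = {}" by (simp add: valid_altdef)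
  then have "w = replicate (length w) 0" by (intro replicate_eqI[OF refl]) auto
  then show "w \<in> zeros" unfolding zeros_def by blast
qed

lemma set_zeros: "w \<in> zeros \<Longrightarrow> x \<in> set w \<Longrightarrow> x = 0"
  by (auto simp: zeros_def)

lemma gf_zeros: "gf dsc zeros * (1 - fps_X) = 1"
proof -
  have "dsc (replicate n (0::nat)) = 0" for n
  proof (induction n)
    case (Suc n) then show ?case by (cases n) simp_all
  qed simp
  moreover have "{w. w \<in> zeros \<and> length w = n} = {replicate n 0}" for n by (auto simp: zeros_def)
  ultimately have "gf dsc zeros $ n = 1" for n by (simp add: gf_def)
  then show ?thesis by (intro fps_ext) (simp add: right_diff_distrib)
qed

lemma sorted_wrt_const: "(\<And>x y. x \<in> set w \<Longrightarrow> y \<in> set w \<Longrightarrow> Q x y) \<Longrightarrow> sorted_wrt Q w"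
  by (induction w) auto

lemma av_all: "(\<And>a b c. a \<in> set w \<Longrightarrow> b \<in> set w \<Longrightarrow> c \<in> set w \<Longrightarrow> \<not> R a b c) \<Longrightarrow> av R w"
  by (induction w) (auto intro!: sorted_wrt_const)

lemma zeros_subset_words: "\<not> R 0 0 0 \<Longrightarrow> zeros \<subseteq> words R"
proof
  fix w assume "\<not> R 0 0 0" "w \<in> zeros"
  then have "av R w" using set_zeros[OF \<open>w \<in> zeros\<close>] by (intro av_all) metis
  then show "w \<in> words R" using \<open>w \<in> zeros\<close> by (simp add: words_def zeros_iff)
qed

lemma valid_common: "p @ q \<in> valid \<Longrightarrow> a \<in> set p \<Longrightarrow> a \<in> set q \<Longrightarrow> a = 0"
  by (auto simp: valid_def)

lemma words_subset: "words R \<subseteq> valid" "perms R \<subseteq> valid" "zeros \<subseteq> valid" "perms R \<subseteq> words R"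
  by (auto simp: words_def perms_def zeros_iff)

lemma Nil_mem: "[] \<in> words R" "[] \<in> perms R" "[] \<in> zeros"
  by (auto simp: words_def perms_def zeros_def valid_def intro: exI[of _ 0])

lemma dsc_max:
  assumes "\<forall>x\<in>set (u @ v). x < M"
  shows "dsc (u @ M # v) = dsc u + (dsc v + of_bool (v \<noteq> []))"
proof -
  have "dsc (M # v) = dsc v + of_bool (v \<noteq> [])" using assms by (cases v) auto
  moreover have "\<not> M < last u" if "u \<noteq> []" using assms last_in_set[OF that] less_asym by (metis UnI1 set_append)
  ultimately show ?thesis by (auto simp: dsc_append)
qed

text \<open>Since u has no 0, its last letter drops to the inserted 0; no descent starts at
  0.\<close>

lemma dsc_zero:
  assumes "0 \<notin> set u"
  shows "dsc (u @ (0::nat) # v) = (dsc u + of_bool (u \<noteq> [])) + dsc v"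
proof -
  have "dsc (0 # v) = dsc v" by (cases v) auto
  moreover have "0 < last u" if "u \<noteq> []" using assms last_in_set[OF that] by (metis gr0I)
  ultimately show ?thesis by (auto simp: dsc_append)
qed

text \<open>The letter M can only act as the 3 of the pattern, which forbids c < a across it. That
  condition also excludes every other occurrence meeting both sides, since its first letter would
  exceed its last.\<close>

lemma av_max_231:
  assumes "\<forall>x\<in>set (u @ v). x < M"
  shows "av r231 (u @ M # v) \<longleftrightarrow> av r231 u \<and> av r231 v \<and> (\<forall>a\<in>set u. \<forall>c\<in>set v. a \<le> c)"
  using assms unfolding av_append
  by (auto simp: r231_def ball_Un intro!: sorted_wrt_const) (force simp: not_less)+

lemma av_max_132:
  assumes "\<forall>x\<in>set (u @ v). x < M"
  shows "av r132 (u @ M # v) \<longleftrightarrow> av r132 u \<and> av r132 v \<and> (\<forall>a\<in>set u. \<forall>c\<in>set v. c \<le> a)"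
  using assms unfolding av_append
  by (auto simp: r132_def ball_Un intro!: sorted_wrt_const) (force simp: not_less)+

lemma av_zero_213:
  assumes "0 \<notin> set u"
  shows "av r213 (u @ (0::nat) # v) \<longleftrightarrow> av r213 u \<and> av r213 v \<and> (\<forall>a\<in>set u. \<forall>c\<in>set v. c \<le> a)"
  using assms unfolding av_append
  by (auto simp: r213_def ball_Un intro!: sorted_wrt_const) (force simp: not_less)+

text \<open>The inserted 0 acts as the 1 of the pattern. A further 0 on the right is harmless
  because it equals the middle letter instead of exceeding it.\<close>

lemma av_zero_312:
  assumes "0 \<notin> set u"
  shows "av r312 (u @ (0::nat) # v) \<longleftrightarrow> av r312 u \<and> av r312 v \<and> (\<forall>a\<in>set u. \<forall>c\<in>set v. c = 0 \<or> a \<le> c)"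
  using assms unfolding av_append
  by (auto simp: r312_def ball_Un intro!: sorted_wrt_const) (force simp: not_less)+

section \<open>Decomposition of avoiding words\<close>

text \<open>In the \<open>join\<close> maps the inserted letter is the new maximum, in the
  \<open>glue\<close> maps it is a 0. The suffix \<open>up\<close> means that the positive letters
  of the right factor lie above those of the left one, \<open>down\<close> the opposite.\<close>

definition join_up :: "nat list \<times> nat list \<Rightarrow> nat list" where
  "join_up = (\<lambda>(u, v). u @ Suc (npos u + npos v) # map (shift (npos u)) v)"

definition join_down :: "nat list \<times> nat list \<Rightarrow> nat list" where
  "join_down = (\<lambda>(u, v). map (shift (npos v)) u @ Suc (npos u + npos v) # v)"

definition glue_up :: "nat list \<times> nat list \<Rightarrow> nat list" where
  "glue_up = (\<lambda>(u, v). u @ 0 # map (shift (npos u)) v)"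

definition glue_down :: "nat list \<times> nat list \<Rightarrow> nat list" where
  "glue_down = (\<lambda>(u, v). map (shift (npos v)) u @ 0 # v)"

lemma shift_eq_iff [simp]: "shift k x = shift k y \<longleftrightarrow> x = y"
  using strict_mono_shift by (simp add: strict_mono_eq)

lemma map_shift_eq_iff [simp]: "map (shift k) u = map (shift k) v \<longleftrightarrow> u = v"
  by (simp add: inj_map_eq_map inj_def)

lemma zero_shift [simp]: "0 = shift k x \<longleftrightarrow> x = 0" "shift k x = 0 \<longleftrightarrow> x = 0"
  by (auto simp: shift_def)

lemma zero_mem_map_shift [simp]: "0 \<in> set (map (shift k) v) \<longleftrightarrow> 0 \<in> set v"
  by (force simp: shift_def image_iff split: if_splits)

lemma valid_shift_append:
  assumes "u \<in> valid" "v \<in> valid"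
  shows "map (shift (npos v)) u @ v \<in> valid" "npos (map (shift (npos v)) u @ v) = npos u + npos v"
  using valid_append_shift[OF assms(2,1)] valid_append_comm npos_append_comm by (metis, metis add.commute)

lemma join_less:
  assumes "u \<in> valid" "v \<in> valid"
  shows "\<forall>x\<in>set (u @ map (shift (npos u)) v). x < Suc (npos u + npos v)"
    "\<forall>x\<in>set (map (shift (npos v)) u @ v). x < Suc (npos u + npos v)"
  using valid_le_npos valid_append_shift[OF assms] valid_shift_append[OF assms] by (metis less_Suc_eq_le)+

lemma join_valid:
  assumes "u \<in> valid" "v \<in> valid"
  shows "join_up (u, v) \<in> valid" "npos (join_up (u, v)) = Suc (npos u + npos v)"
    "join_down (u, v) \<in> valid" "npos (join_down (u, v)) = Suc (npos u + npos v)"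
  using valid_insert_max[OF valid_append_shift(1)[OF assms]] valid_insert_max[OF valid_shift_append(1)[OF assms]]
  by (simp_all add: join_up_def join_down_def valid_append_shift(2)[OF assms] valid_shift_append(2)[OF assms])

lemma glue_valid:
  assumes "u \<in> valid" "v \<in> valid"
  shows "glue_up (u, v) \<in> valid" "glue_down (u, v) \<in> valid"
  using valid_append_shift(1)[OF assms] valid_shift_append(1)[OF assms]
  by (simp_all add: glue_up_def glue_down_def valid_insert_0)

text \<open>The inserted maximum is determined by \<open>npos\<close> of the joined word and occurs
  once, so both factors can be read off around it.\<close>

lemma inj_join_up: "inj_on join_up (valid \<times> valid)"
proof (rule inj_onI, clarify)
  fix u v u' v' assume v: "u \<in> valid" "v \<in> valid" "u' \<in> valid" "v' \<in> valid"
    and eq: "join_up (u, v) = join_up (u', v')"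
  define M where "M = Suc (npos u + npos v)"
  have M': "Suc (npos u' + npos v') = M" using join_valid(2) v eq unfolding M_def by metis
  have "M \<notin> set u" "M \<notin> set (map (shift (npos u)) v)"
    using join_less(1)[OF v(1,2)] unfolding M_def by (auto simp del: set_map)
  then have "u = u' \<and> map (shift (npos u)) v = map (shift (npos u')) v'"
    using eq unfolding join_up_def split M' M_def[symmetric] by (metis append_Cons_eq_iff)
  then show "u = u' \<and> v = v'" by (metis map_shift_eq_iff)
qed

lemma inj_join_down: "inj_on join_down (valid \<times> valid)"
proof (rule inj_onI, clarify)
  fix u v u' v' assume v: "u \<in> valid" "v \<in> valid" "u' \<in> valid" "v' \<in> valid"
    and eq: "join_down (u, v) = join_down (u', v')"
  define M where "M = Suc (npos u + npos v)"
  have M': "Suc (npos u' + npos v') = M" using join_valid(4) v eq unfolding M_def by metis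
  have "M \<notin> set v" "M \<notin> set (map (shift (npos v)) u)"
    using join_less(2)[OF v(1,2)] unfolding M_def by (auto simp del: set_map)
  then have "map (shift (npos v)) u = map (shift (npos v')) u' \<and> v = v'"
    using eq unfolding join_down_def split M' M_def[symmetric] by (metis append_Cons_eq_iff)
  then show "u = u' \<and> v = v'" by (metis map_shift_eq_iff)
qed

lemma append_zero_eq_iff:
  "0 \<notin> set u \<Longrightarrow> 0 \<notin> set u' \<Longrightarrow> u @ (0::nat) # v = u' @ 0 # v' \<longleftrightarrow> u = u' \<and> v = v'"
  by (induction u arbitrary: u') (case_tac u'; force)+

text \<open>The first factor has no 0, so the inserted letter is recovered as the first 0 of the
  word.\<close>

lemma inj_glue_up: "inj_on glue_up (perms R \<times> words R)"
proof (rule inj_onI, clarify)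
  fix u v u' v' assume "u \<in> perms R" "u' \<in> perms R" and eq: "glue_up (u, v) = glue_up (u', v')"
  then have "u = u' \<and> map (shift (npos u)) v = map (shift (npos u')) v'"
    unfolding glue_up_def split by (subst (asm) append_zero_eq_iff) (auto simp: perms_def)
  then show "u = u' \<and> v = v'" by auto
qed

lemma inj_glue_down: "inj_on glue_down (perms R \<times> words R)"
proof (rule inj_onI, clarify)
  fix u v u' v' assume "u \<in> perms R" "u' \<in> perms R" and eq: "glue_down (u, v) = glue_down (u', v')"
  then have "map (shift (npos v)) u = map (shift (npos v')) u' \<and> v = v'"
    unfolding glue_down_def split by (subst (asm) append_zero_eq_iff) (auto simp: perms_def simp del: set_map)
  then show "u = u' \<and> v = v'" by auto
qed

lemma dsc_join:
  assumes "u \<in> valid" "v \<in> valid"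
  shows "dsc (join_up (u, v)) = dsc u + aug v" "dsc (join_down (u, v)) = dsc u + aug v"
  using dsc_max[OF join_less(1)[OF assms]] dsc_max[OF join_less(2)[OF assms]]
  by (simp_all add: join_up_def join_down_def aug_def dsc_map[OF strict_mono_shift])

lemma dsc_glue:
  assumes "u \<in> perms R"
  shows "dsc (glue_up (u, v)) = aug u + dsc v" "dsc (glue_down (u, v)) = aug u + dsc v"
proof -
  have u: "0 \<notin> set u" "0 \<notin> set (map (shift k) u)" for k using assms by (auto simp: perms_def simp del: set_map)
  show "dsc (glue_up (u, v)) = aug u + dsc v" "dsc (glue_down (u, v)) = aug u + dsc v"
    using dsc_zero[OF u(1)] dsc_zero[OF u(2)]
    by (simp_all add: glue_up_def glue_down_def aug_def dsc_map[OF strict_mono_shift])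
qed

lemma length_join [simp]:
  "length (join_up (u, v)) = Suc (length u + length v)" "length (join_down (u, v)) = Suc (length u + length v)"
  "length (glue_up (u, v)) = Suc (length u + length v)" "length (glue_down (u, v)) = Suc (length u + length v)"
  by (simp_all add: join_up_def join_down_def glue_up_def glue_down_def)

lemma mem_shift:
  assumes "x \<in> set (map (shift k) v)" shows "x = 0 \<and> 0 \<in> set v \<or> k < x"
  using assms by (auto simp: shift_def)

text \<open>Avoidance across the maximum asks a \<le> c for a on the left and c on the right.
  Stacking ensures it for positive c; a letter c = 0 forces the left side to be all zeros, whence
  the third assumption.\<close>

lemma join_up_mem:
  assumes "u \<in> words r231" "v \<in> words r231" "u \<in> zeros \<or> v \<in> perms r231"
  shows "join_up (u, v) \<in> words r231 - zeros"
proof -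
  have v: "u \<in> valid" "v \<in> valid" and a: "av r231 u" "av r231 v" using assms by (auto simp: words_def)
  have "a \<le> c" if "a \<in> set u" "c \<in> set (map (shift (npos u)) v)" for a c
    using assms(3)
  proof
    assume "u \<in> zeros" then show ?thesis using set_zeros that(1) by fastforce
  next
    assume "v \<in> perms r231"
    then have "0 \<notin> set v" by (simp add: perms_def)
    then show ?thesis using mem_shift[OF that(2)] valid_le_npos[OF v(1) that(1)] by auto
  qed
  then have "av r231 (join_up (u, v))"
    unfolding join_up_def split av_max_231[OF join_less(1)[OF v]]
    using a by (simp add: av_map_strict_mono[OF strict_mono_shift])
  then show ?thesis using join_valid[OF v] by (simp add: words_def zeros_iff)
qed

text \<open>Here the condition across the maximum is c \<le> a, so a 0 on the left forces the right
  side to be all zeros.\<close>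

lemma join_down_mem:
  assumes "u \<in> words r132" "v \<in> words r132" "u \<in> perms r132 \<or> v \<in> zeros"
  shows "join_down (u, v) \<in> words r132 - zeros"
proof -
  have v: "u \<in> valid" "v \<in> valid" and a: "av r132 u" "av r132 v" using assms by (auto simp: words_def)
  have "c \<le> a" if "a \<in> set (map (shift (npos v)) u)" "c \<in> set v" for a c
    using assms(3)
  proof
    assume "v \<in> zeros" then show ?thesis using set_zeros that(2) by fastforce
  next
    assume "u \<in> perms r132"
    then have "0 \<notin> set u" by (simp add: perms_def)
    then show ?thesis using mem_shift[OF that(1)] valid_le_npos[OF v(2) that(2)] by auto
  qed
  then have "av r132 (join_down (u, v))"
    unfolding join_down_def split av_max_132[OF join_less(2)[OF v]]
    using a by (simp add: av_map_strict_mono[OF strict_mono_shift])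
  then show ?thesis using join_valid[OF v] by (simp add: words_def zeros_iff)
qed

lemma glue_up_mem:
  assumes "u \<in> perms r312" "v \<in> words r312"
  shows "glue_up (u, v) \<in> words r312 - perms r312"
proof -
  have v: "u \<in> valid" "v \<in> valid" and a: "av r312 u" "av r312 v" and u: "0 \<notin> set u"
    using assms by (auto simp: words_def perms_def)
  have "c = 0 \<or> a \<le> c" if "a \<in> set u" "c \<in> set (map (shift (npos u)) v)" for a c
    using mem_shift[OF that(2)] valid_le_npos[OF v(1) that(1)] by auto
  then have "av r312 (glue_up (u, v))"
    unfolding glue_up_def split av_zero_312[OF u]
    using a by (simp add: av_map_strict_mono[OF strict_mono_shift])
  then show ?thesis using glue_valid[OF v] by (simp add: words_def perms_def glue_up_def)
qed

lemma glue_down_mem: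
  assumes "u \<in> perms r213" "v \<in> words r213"
  shows "glue_down (u, v) \<in> words r213 - perms r213"
proof -
  have v: "u \<in> valid" "v \<in> valid" and a: "av r213 u" "av r213 v" and u: "0 \<notin> set (map (shift (npos v)) u)"
    using assms by (auto simp: words_def perms_def simp del: set_map)
  have "c \<le> a" if "a \<in> set (map (shift (npos v)) u)" "c \<in> set v" for a c
    using mem_shift[OF that(1)] valid_le_npos[OF v(2) that(2)] u that(1) by (auto simp del: set_map)
  then have "av r213 (glue_down (u, v))"
    unfolding glue_down_def split av_zero_213[OF u]
    using a by (simp add: av_map_strict_mono[OF strict_mono_shift])
  then show ?thesis using glue_valid[OF v] by (simp add: words_def perms_def glue_down_def)
qed

lemma join_upE:
  assumes "w \<in> words r231 - zeros"
  obtains u v where "w = join_up (u, v)" "u \<in> words r231" "v \<in> words r231" "u \<in> zeros \<or> v \<in> perms r231"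
proof -
  have w: "w \<in> valid" "av r231 w" "npos w \<noteq> 0" using assms by (auto simp: words_def zeros_iff)
  obtain p q where pq: "w = p @ Suc (npos (p @ q)) # q" "p @ q \<in> valid" "\<forall>x\<in>set (p @ q). x < Suc (npos (p @ q))"
    using valid_maxE[OF w(1,3)] .
  have a: "av r231 p" "av r231 q" and le: "\<forall>a\<in>set p. \<forall>c\<in>set q. a \<le> c"
    using w(2) av_max_231[OF pq(3)] unfolding pq(1)[symmetric] by auto
  obtain v where v: "p \<in> valid" "v \<in> valid" "q = map (shift (npos p)) v"
    \<comment> \<open>The weak inequality from avoidance is strict on positive letters, since the
      two sides of a valid word share no letter but 0.\<close>
    using pq(2) by (rule valid_appendE) (metis le valid_common[OF pq(2)] le_neq_implies_less less_irrefl)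
  have n: "npos (p @ q) = npos p + npos v" unfolding v(3) using valid_append_shift(2)[OF v(1,2)] .
  have "w = join_up (p, v)" using pq(1) unfolding n unfolding v(3) by (simp add: join_up_def)
  moreover have pw: "p \<in> words r231" and vw: "v \<in> words r231"
    using a v by (simp_all add: words_def av_map_strict_mono[OF strict_mono_shift])
  moreover have "p \<in> zeros \<or> v \<in> perms r231"
  proof (cases "0 \<in> set v")
    case True
    then have "0 \<in> set q" unfolding v(3) by (simp del: set_map)
    then have "set p - {0} = {}" using le by auto
    then show ?thesis using v(1) by (simp add: zeros_iff npos_def)
  qed (simp add: perms_def vw)
  ultimately show thesis using that by blast
qed

lemma join_downE:
  assumes "w \<in> words r132 - zeros"
  obtains u v where "w = join_down (u, v)" "u \<in> words r132" "v \<in> words r132" "u \<in> perms r132 \<or> v \<in> zeros"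
proof -
  have w: "w \<in> valid" "av r132 w" "npos w \<noteq> 0" using assms by (auto simp: words_def zeros_iff)
  obtain p q where pq: "w = p @ Suc (npos (p @ q)) # q" "p @ q \<in> valid" "\<forall>x\<in>set (p @ q). x < Suc (npos (p @ q))"
    using valid_maxE[OF w(1,3)] .
  have a: "av r132 p" "av r132 q" and le: "\<forall>a\<in>set p. \<forall>c\<in>set q. c \<le> a"
    using w(2) av_max_132[OF pq(3)] unfolding pq(1)[symmetric] by auto
  have qp: "q @ p \<in> valid" using pq(2) valid_append_comm by blast
  obtain u where v: "q \<in> valid" "u \<in> valid" "p = map (shift (npos q)) u"
    using qp by (rule valid_appendE) (metis le valid_common[OF qp] le_neq_implies_less less_irrefl)
  have n: "npos (p @ q) = npos u + npos q" unfolding v(3) using valid_shift_append(2)[OF v(2,1)] .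
  have "w = join_down (u, q)" using pq(1) unfolding n unfolding v(3) by (simp add: join_down_def)
  moreover have pw: "u \<in> words r132" and vw: "q \<in> words r132"
    using a v by (simp_all add: words_def av_map_strict_mono[OF strict_mono_shift])
  moreover have "u \<in> perms r132 \<or> q \<in> zeros"
  proof (cases "0 \<in> set u")
    case True
    then have "0 \<in> set p" unfolding v(3) by (simp del: set_map)
    then have "set q - {0} = {}" using le by auto
    then show ?thesis using v(1) by (simp add: zeros_iff npos_def)
  qed (simp add: perms_def pw)
  ultimately show thesis using that by blast
qed

lemma glue_upE:
  assumes "w \<in> words r312 - perms r312"
  obtains u v where "w = glue_up (u, v)" "u \<in> perms r312" "v \<in> words r312"
proof -
  have w: "w \<in> valid" "av r312 w" "0 \<in> set w" using assms by (auto simp: words_def perms_def)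
  obtain p q where pq: "w = p @ 0 # q" "0 \<notin> set p" using split_list_first[OF w(3)] by blast
  have a: "av r312 p" "av r312 q" and le: "\<forall>a\<in>set p. \<forall>c\<in>set q. c = 0 \<or> a \<le> c"
    using w(2) unfolding pq(1) av_zero_312[OF pq(2)] by auto
  have val: "p @ q \<in> valid" using w(1) unfolding pq(1) valid_insert_0 .
  obtain v where v: "p \<in> valid" "v \<in> valid" "q = map (shift (npos p)) v"
    using val by (rule valid_appendE) (metis le valid_common[OF val] le_neq_implies_less less_irrefl)
  have "w = glue_up (p, v)" using pq(1) unfolding v(3) by (simp add: glue_up_def)
  moreover have pw: "p \<in> perms r312" and vw: "v \<in> words r312"
    using a v pq(2) by (simp_all add: words_def perms_def av_map_strict_mono[OF strict_mono_shift])
  ultimately show thesis using that by blast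
qed

lemma glue_downE:
  assumes "w \<in> words r213 - perms r213"
  obtains u v where "w = glue_down (u, v)" "u \<in> perms r213" "v \<in> words r213"
proof -
  have w: "w \<in> valid" "av r213 w" "0 \<in> set w" using assms by (auto simp: words_def perms_def)
  obtain p q where pq: "w = p @ 0 # q" "0 \<notin> set p" using split_list_first[OF w(3)] by blast
  have a: "av r213 p" "av r213 q" and le: "\<forall>a\<in>set p. \<forall>c\<in>set q. c \<le> a"
    using w(2) unfolding pq(1) av_zero_213[OF pq(2)] by auto
  have "p @ q \<in> valid" using w(1) unfolding pq(1) valid_insert_0 .
  then have qp: "q @ p \<in> valid" using valid_append_comm by blast
  obtain u where v: "q \<in> valid" "u \<in> valid" "p = map (shift (npos q)) u"
    using qp by (rule valid_appendE) (metis le valid_common[OF qp] le_neq_implies_less less_irrefl)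
  have "w = glue_down (u, q)" using pq(1) unfolding v(3) by (simp add: glue_down_def)
  moreover have "0 \<notin> set u" using pq(2) unfolding v(3) by (simp del: set_map)
  then have pw: "u \<in> perms r213" and vw: "q \<in> words r213"
    using a v by (simp_all add: words_def perms_def av_map_strict_mono[OF strict_mono_shift])
  ultimately show thesis using that by blast
qed

text \<open>The overlapping alternatives of \<open>join_upE\<close> are made disjoint by asking
  first whether the left factor is all zeros, so that the generating functions add.\<close>

lemma words_231_decomp:
  "words r231 - zeros = join_up ` (zeros \<times> words r231) \<union> join_up ` ((words r231 - zeros) \<times> perms r231)"
proof (intro equalityI subsetI)
  fix w assume "w \<in> words r231 - zeros"
  then obtain u v where "w = join_up (u, v)" "u \<in> words r231" "v \<in> words r231" "u \<in> zeros \<or> v \<in> perms r231"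
    by (rule join_upE)
  then show "w \<in> join_up ` (zeros \<times> words r231) \<union> join_up ` ((words r231 - zeros) \<times> perms r231)"
    by (cases "u \<in> zeros") blast+
next
  have z: "zeros \<subseteq> words r231" by (rule zeros_subset_words) (simp add: r231_def)
  fix w assume "w \<in> join_up ` (zeros \<times> words r231) \<union> join_up ` ((words r231 - zeros) \<times> perms r231)"
  then obtain u v where "w = join_up (u, v)" "u \<in> words r231" "v \<in> words r231" "u \<in> zeros \<or> v \<in> perms r231"
    using z words_subset(4)[of r231] by blast
  then show "w \<in> words r231 - zeros" using join_up_mem by blast
qed

text \<open>Disjointness comes from asking first whether the left factor contains a 0.\<close>

lemma words_132_decomp:
  "words r132 - zeros = join_down ` (perms r132 \<times> words r132) \<union> join_down ` ((words r132 - perms r132) \<times> zeros)"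
proof (intro equalityI subsetI)
  fix w assume "w \<in> words r132 - zeros"
  then obtain u v where "w = join_down (u, v)" "u \<in> words r132" "v \<in> words r132" "u \<in> perms r132 \<or> v \<in> zeros"
    by (rule join_downE)
  then show "w \<in> join_down ` (perms r132 \<times> words r132) \<union> join_down ` ((words r132 - perms r132) \<times> zeros)"
    by (cases "u \<in> perms r132") blast+
next
  have z: "zeros \<subseteq> words r132" by (rule zeros_subset_words) (simp add: r132_def)
  fix w assume "w \<in> join_down ` (perms r132 \<times> words r132) \<union> join_down ` ((words r132 - perms r132) \<times> zeros)"
  then obtain u v where "w = join_down (u, v)" "u \<in> words r132" "v \<in> words r132" "u \<in> perms r132 \<or> v \<in> zeros"
    using z words_subset(4)[of r132] by blast
  then show "w \<in> words r132 - zeros" using join_down_mem by blast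
qed

lemma words_312_decomp: "words r312 - perms r312 = glue_up ` (perms r312 \<times> words r312)"
proof (intro equalityI subsetI)
  fix w assume "w \<in> words r312 - perms r312"
  then obtain u v where "w = glue_up (u, v)" "u \<in> perms r312" "v \<in> words r312" by (rule glue_upE)
  then show "w \<in> glue_up ` (perms r312 \<times> words r312)" by blast
next
  fix w assume "w \<in> glue_up ` (perms r312 \<times> words r312)"
  then obtain u v where "w = glue_up (u, v)" "u \<in> perms r312" "v \<in> words r312" by blast
  then show "w \<in> words r312 - perms r312" using glue_up_mem by blast
qed

lemma words_213_decomp: "words r213 - perms r213 = glue_down ` (perms r213 \<times> words r213)"
proof (intro equalityI subsetI)
  fix w assume "w \<in> words r213 - perms r213"
  then obtain u v where "w = glue_down (u, v)" "u \<in> perms r213" "v \<in> words r213" by (rule glue_downE)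
  then show "w \<in> glue_down ` (perms r213 \<times> words r213)" by blast
next
  fix w assume "w \<in> glue_down ` (perms r213 \<times> words r213)"
  then obtain u v where "w = glue_down (u, v)" "u \<in> perms r213" "v \<in> words r213" by blast
  then show "w \<in> words r213 - perms r213" using glue_down_mem by blast
qed

lemma perms_zeros: "w \<in> perms R \<Longrightarrow> w \<in> zeros \<longleftrightarrow> w = []"
  by (auto simp: perms_def zeros_def)

lemma perms_231_decomp: "perms r231 - {[]} = join_up ` (perms r231 \<times> perms r231)"
proof (intro equalityI subsetI)
  fix w assume w: "w \<in> perms r231 - {[]}"
  then have "w \<in> words r231 - zeros" using perms_zeros words_subset(4) by blast
  then obtain u v where uv: "w = join_up (u, v)" "u \<in> words r231" "v \<in> words r231" by (rule join_upE)
  moreover have "0 \<notin> set w" using w by (simp add: perms_def)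
  ultimately show "w \<in> join_up ` (perms r231 \<times> perms r231)"
    by (auto simp: perms_def join_up_def)
next
  fix w assume "w \<in> join_up ` (perms r231 \<times> perms r231)"
  then obtain u v where uv: "w = join_up (u, v)" "u \<in> perms r231" "v \<in> perms r231" by auto
  then have "w \<in> words r231 - zeros" using join_up_mem words_subset(4) by blast
  moreover have "0 \<notin> set w" using uv by (auto simp: perms_def join_up_def)
  ultimately show "w \<in> perms r231 - {[]}" using Nil_mem(3) by (auto simp: perms_def)
qed

lemma perms_132_decomp: "perms r132 - {[]} = join_down ` (perms r132 \<times> perms r132)"
proof (intro equalityI subsetI)
  fix w assume w: "w \<in> perms r132 - {[]}"
  then have "w \<in> words r132 - zeros" using perms_zeros words_subset(4) by blast
  then obtain u v where uv: "w = join_down (u, v)" "u \<in> words r132" "v \<in> words r132" by (rule join_downE)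
  moreover have "0 \<notin> set w" using w by (simp add: perms_def)
  ultimately show "w \<in> join_down ` (perms r132 \<times> perms r132)"
    by (auto simp: perms_def join_down_def)
next
  fix w assume "w \<in> join_down ` (perms r132 \<times> perms r132)"
  then obtain u v where uv: "w = join_down (u, v)" "u \<in> perms r132" "v \<in> perms r132" by auto
  then have "w \<in> words r132 - zeros" using join_down_mem words_subset(4) by blast
  moreover have "0 \<notin> set w" using uv by (auto simp: perms_def join_down_def)
  ultimately show "w \<in> perms r132 - {[]}" using Nil_mem(3) by (auto simp: perms_def)
qed

text \<open>With exactly one 0 present, that 0 can serve as the least letter of a permutation. This
  lets the decomposition at a 0 be reused for permutations split at their minimum.\<close>

lemma valid_map_Suc:
  assumes "p @ 0 # q \<in> valid" "0 \<notin> set p" "0 \<notin> set q"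
  shows "map Suc (p @ 0 # q) \<in> valid"
proof -
  have nz: "filter ((\<noteq>) 0) p = p" "filter ((\<noteq>) 0) q = q" "filter ((\<noteq>) 0) (map Suc (p @ 0 # q)) = map Suc (p @ 0 # q)"
    by (intro filter_True ballI; use assms in \<open>metis | fastforce\<close>)+
  obtain m where m: "set (p @ 0 # q) - {0} = {1..m}" using assms(1) by (auto simp: valid_def)
  have "filter ((\<noteq>) 0) (p @ 0 # q) = p @ q" unfolding filter_append filter.simps nz by simp
  then have "distinct (p @ q)" using assms(1) by (simp only: valid_def mem_Collect_eq)
  then have "distinct (p @ 0 # q)" using assms(2,3) by simp
  then have "distinct (map Suc (p @ 0 # q))" by (simp only: distinct_map inj_Suc inj_on_subset[OF inj_Suc] subset_UNIV)
  moreover have "set (map Suc (p @ 0 # q)) - {0} = {1..Suc m}"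
  proof -
    have "set (p @ 0 # q) = insert 0 {1..m}" using m by auto
    also have "\<dots> = {0..m}" by auto
    finally have "set (map Suc (p @ 0 # q)) = Suc ` {0..m}" by (simp only: set_map)
    then show ?thesis by (simp only: image_Suc_atLeastAtMost) auto
  qed
  ultimately show ?thesis unfolding valid_def mem_Collect_eq nz(3) by blast
qed

lemma valid_SucE:
  assumes "w \<in> valid" "0 \<notin> set w" "w \<noteq> []"
  obtains p q where "w = map Suc (p @ 0 # q)" "0 \<notin> set p" "0 \<notin> set q" "p @ 0 # q \<in> valid"
proof -
  obtain m where m: "set w - {0} = {1..m}" using assms(1) by (auto simp: valid_def)
  then have sw: "set w = {1..m}" using assms(2) by simp
  have "filter ((\<noteq>) 0) w = w" by (intro filter_True ballI) (use assms(2) in metis)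
  then have dw: "distinct w" using assms(1) by (simp add: valid_def)
  have m0: "m \<noteq> 0"
  proof
    assume "m = 0"
    then have "set w = {}" using sw by simp
    then show False using assms(3) by simp
  qed
  define w' where "w' = map (\<lambda>x. x - 1) w"
  have ww: "w = map Suc w'" unfolding w'_def map_map by (rule map_idI[symmetric]) (use sw in auto)
  have dw': "distinct w'" using dw unfolding ww by (simp add: distinct_map)
  have "Suc ` set w' = Suc ` {0..m-1}" using sw m0 unfolding ww image_Suc_atLeastAtMost by simp
  then have sw': "set w' = {0..m-1}" by (simp only: inj_image_eq_iff[OF inj_Suc])
  then have "0 \<in> set w'" by simp
  then obtain p q where pq: "w' = p @ 0 # q" by (meson split_list)
  have "set w' - {0} = {1..m-1}" unfolding sw' by auto
  moreover have "distinct (filter ((\<noteq>) 0) w')" using dw' by simp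
  ultimately have "w' \<in> valid" unfolding valid_def by blast
  then show thesis using that[of p q] ww dw' unfolding pq by simp
qed

lemma strict_mono_Suc: "strict_mono Suc"
  by (simp add: strict_mono_def)

text \<open>Lowering all letters by one turns a nonempty permutation into a word with exactly one $0$.\<close>

lemma perms_312_decomp: "perms r312 - {[]} = map Suc ` glue_up ` (perms r312 \<times> perms r312)"
proof (intro equalityI subsetI)
  fix w assume w: "w \<in> perms r312 - {[]}"
  then obtain p q where pq: "w = map Suc (p @ 0 # q)" "0 \<notin> set p" "0 \<notin> set q" "p @ 0 # q \<in> valid"
    using valid_SucE[of w] by (auto simp: perms_def words_def)
  have "p @ 0 # q \<in> words r312 - perms r312"
    using w pq(4) unfolding pq(1) perms_def words_def by (simp add: av_map_strict_mono[OF strict_mono_Suc] del: map_append list.map)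
  then obtain u v where uv: "p @ 0 # q = glue_up (u, v)" "u \<in> perms r312" "v \<in> words r312"
    by (rule glue_upE)
  have "q = map (shift (npos u)) v"
    using uv(1,2) pq(2) unfolding glue_up_def split by (subst (asm) append_zero_eq_iff) (auto simp: perms_def)
  then have "v \<in> perms r312" using pq(3) uv(3) by (simp add: perms_def del: set_map)
  then show "w \<in> map Suc ` glue_up ` (perms r312 \<times> perms r312)" using uv pq(1) by blast
next
  fix w assume "w \<in> map Suc ` glue_up ` (perms r312 \<times> perms r312)"
  then obtain u v where uv: "w = map Suc (glue_up (u, v))" "u \<in> perms r312" "v \<in> perms r312" by auto
  then have g: "glue_up (u, v) \<in> words r312" using glue_up_mem words_subset(4) by blast
  have "w \<in> valid" unfolding uv(1) glue_up_def split
    by (rule valid_map_Suc) (use uv g in \<open>auto simp: glue_up_def perms_def words_def simp del: set_map\<close>)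
  then show "w \<in> perms r312 - {[]}" using g uv(1)
    by (auto simp: perms_def words_def av_map_strict_mono[OF strict_mono_Suc] glue_up_def simp del: map_append list.map)
qed

lemma perms_213_decomp: "perms r213 - {[]} = map Suc ` glue_down ` (perms r213 \<times> perms r213)"
proof (intro equalityI subsetI)
  fix w assume w: "w \<in> perms r213 - {[]}"
  then obtain p q where pq: "w = map Suc (p @ 0 # q)" "0 \<notin> set p" "0 \<notin> set q" "p @ 0 # q \<in> valid"
    using valid_SucE[of w] by (auto simp: perms_def words_def)
  have "p @ 0 # q \<in> words r213 - perms r213"
    using w pq(4) unfolding pq(1) perms_def words_def by (simp add: av_map_strict_mono[OF strict_mono_Suc] del: map_append list.map)
  then obtain u v where uv: "p @ 0 # q = glue_down (u, v)" "u \<in> perms r213" "v \<in> words r213"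
    by (rule glue_downE)
  have "q = v"
    using uv(1,2) pq(2) unfolding glue_down_def split by (subst (asm) append_zero_eq_iff) (auto simp: perms_def simp del: set_map)
  then have "v \<in> perms r213" using pq(3) uv(3) by (simp add: perms_def del: set_map)
  then show "w \<in> map Suc ` glue_down ` (perms r213 \<times> perms r213)" using uv pq(1) by blast
next
  fix w assume "w \<in> map Suc ` glue_down ` (perms r213 \<times> perms r213)"
  then obtain u v where uv: "w = map Suc (glue_down (u, v))" "u \<in> perms r213" "v \<in> perms r213" by auto
  then have g: "glue_down (u, v) \<in> words r213" using glue_down_mem words_subset(4) by blast
  have "w \<in> valid" unfolding uv(1) glue_down_def split
    by (rule valid_map_Suc) (use uv g in \<open>auto simp: glue_down_def perms_def words_def simp del: set_map\<close>)
  then show "w \<in> perms r213 - {[]}" using g uv(1)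
    by (auto simp: perms_def words_def av_map_strict_mono[OF strict_mono_Suc] glue_down_def simp del: map_append list.map)
qed

section \<open>Functional equations for the generating functions\<close>

lemma gf_perms_Diff: "gf dsc (perms R - {[]}) = gf dsc (perms R) - 1"
proof -
  have "gf dsc {[] :: nat list} = 1"
  proof (rule fps_ext)
    fix n
    have "{w :: nat list. w \<in> {[]} \<and> length w = n} = (if n = 0 then {[]} else {})" by auto
    then show "gf dsc {[] :: nat list} $ n = 1 $ n" by (simp add: gf_def)
  qed
  moreover have "gf dsc (perms R - {[]}) = gf dsc (perms R) - gf dsc {[] :: nat list}"
    using Nil_mem(2) words_subset(2) by (intro gf_Diff) auto
  ultimately show ?thesis by simp
qed

lemma gf_join:
  assumes "S \<subseteq> valid" "T \<subseteq> valid" "[] \<in> T"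
  shows "gf dsc (join_up ` (S \<times> T)) = fps_X * (gf dsc S * (1 + tt * (gf dsc T - 1)))"
    "gf dsc (join_down ` (S \<times> T)) = fps_X * (gf dsc S * (1 + tt * (gf dsc T - 1)))"
  unfolding gf_aug[OF assms(3), symmetric]
proof -
  have i: "inj_on join_up (S \<times> T)" "inj_on join_down (S \<times> T)"
    using inj_on_subset[OF inj_join_up] inj_on_subset[OF inj_join_down] assms by (meson Sigma_mono)+
  have d: "dsc (join_up (u, v)) = dsc u + aug v" "dsc (join_down (u, v)) = dsc u + aug v"
    if "u \<in> S" "v \<in> T" for u v using that assms dsc_join by blast+
  show "gf dsc (join_up ` (S \<times> T)) = fps_X * (gf dsc S * gf aug T)"
    using assms(1,2) i(1) length_join(1) d(1) by (rule gf_prod)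
  show "gf dsc (join_down ` (S \<times> T)) = fps_X * (gf dsc S * gf aug T)"
    using assms(1,2) i(2) length_join(2) d(2) by (rule gf_prod)
qed

lemma gf_glue:
  assumes "T \<subseteq> words R"
  shows "gf dsc (glue_up ` (perms R \<times> T)) = fps_X * ((1 + tt * (gf dsc (perms R) - 1)) * gf dsc T)"
    "gf dsc (glue_down ` (perms R \<times> T)) = fps_X * ((1 + tt * (gf dsc (perms R) - 1)) * gf dsc T)"
  unfolding gf_aug[OF Nil_mem(2), symmetric]
proof -
  have T: "T \<subseteq> valid" using assms words_subset(1) by blast
  have "inj_on glue_up (perms R \<times> T)" "inj_on glue_down (perms R \<times> T)"
    by (rule inj_on_subset[OF inj_glue_up[of R]] inj_on_subset[OF inj_glue_down[of R]]; use assms in auto)+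
  then show "gf dsc (glue_up ` (perms R \<times> T)) = fps_X * (gf aug (perms R) * gf dsc T)"
    "gf dsc (glue_down ` (perms R \<times> T)) = fps_X * (gf aug (perms R) * gf dsc T)"
    by (intro gf_prod words_subset T; simp add: dsc_glue)+
qed

lemma gf_map_Suc: "gf dsc (map Suc ` S) = gf dsc S"
  by (rule gf_image) (auto simp: dsc_map[OF strict_mono_Suc] inj_on_def)

lemma gf_perms:
  assumes "R \<in> {r213, r312, r231, r132}"
  shows "gf dsc (perms R) = narayana_fps"
proof (rule narayana_fps_unique)
  have "gf dsc (perms R - {[]}) = fps_X * (gf dsc (perms R) * (1 + tt * (gf dsc (perms R) - 1)))"
    using assms unfolding insert_iff
    by (elim disjE) (simp_all add: perms_213_decomp perms_312_decomp perms_231_decomp perms_132_decomp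
      gf_map_Suc gf_glue gf_join words_subset Nil_mem mult.commute)
  then show "gf dsc (perms R) = 1 + fps_X * gf dsc (perms R) * (1 + tt * (gf dsc (perms R) - 1))"
    unfolding gf_perms_Diff by (simp add: mult.assoc algebra_simps)
qed

lemma inj_on_image_disjoint:
  "inj_on f V \<Longrightarrow> A \<subseteq> V \<Longrightarrow> B \<subseteq> V \<Longrightarrow> A \<inter> B = {} \<Longrightarrow> f ` A \<inter> f ` B = {}"
  by (metis image_empty inj_on_image_Int)

lemma gf_eq_narayana_fps_sq:
  assumes "(f - narayana_fps\<^sup>2) * c = 0" "c $ 0 = 1"
  shows "f = narayana_fps\<^sup>2"
proof -
  have "c \<noteq> 0" using assms(2) by auto
  then show ?thesis using assms(1) by simp
qed

text \<open>With K = 1 + t(A-1), the decomposition says F(1 - xK) = A, while the equation of A says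
  A(1 - xK) = 1; hence F = A^2.\<close>

lemma gf_words_213_312:
  assumes "R \<in> {r213, r312}"
  shows "gf dsc (words R) = narayana_fps\<^sup>2"
proof -
  let ?F = "gf dsc (words R)"
  have "gf dsc (words R - perms R) = fps_X * ((1 + tt * (narayana_fps - 1)) * ?F)"
    using assms gf_glue[OF subset_refl, of R] gf_perms[of R] words_213_decomp words_312_decomp by auto
  then have "?F - narayana_fps = fps_X * ((1 + tt * (narayana_fps - 1)) * ?F)"
    using gf_Diff[OF words_subset(1,4)] gf_perms[of R] assms by auto
  then have "(?F - narayana_fps\<^sup>2) * (1 - fps_X * (1 + tt * (narayana_fps - 1))) = 0"
    using narayana_fps_quadratic by algebra
  then show ?thesis by (rule gf_eq_narayana_fps_sq) simp
qed

lemma gf_words_231: "gf dsc (words r231) = narayana_fps\<^sup>2"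
proof -
  let ?F = "gf dsc (words r231)" and ?z = "gf dsc zeros"
  have z: "zeros \<subseteq> words r231" by (rule zeros_subset_words) (simp add: r231_def)
  have A: "gf dsc (perms r231) = narayana_fps" by (simp add: gf_perms)
  have v: "words r231 - zeros \<subseteq> valid" using words_subset(1) by blast
  have im: "join_up ` (zeros \<times> words r231) \<subseteq> valid" "join_up ` ((words r231 - zeros) \<times> perms r231) \<subseteq> valid"
    using words_231_decomp v by blast+
  have "gf dsc (words r231 - zeros) = gf dsc (join_up ` (zeros \<times> words r231)) + gf dsc (join_up ` ((words r231 - zeros) \<times> perms r231))"
  proof (rule trans[OF arg_cong[where f = "gf dsc", OF words_231_decomp] gf_Un[OF im]])
    show "join_up ` (zeros \<times> words r231) \<inter> join_up ` ((words r231 - zeros) \<times> perms r231) = {}"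
      by (rule inj_on_image_disjoint[OF inj_join_up]) (use words_subset in auto)
  qed
  also have "\<dots> = fps_X * (?z * (1 + tt * (?F - 1))) + fps_X * ((?F - ?z) * (1 + tt * (narayana_fps - 1)))"
    by (simp add: gf_join words_subset Nil_mem v gf_Diff[OF words_subset(1) z] A)
  finally have "?F - ?z = fps_X * (?z * (1 + tt * (?F - 1))) + fps_X * ((?F - ?z) * (1 + tt * (narayana_fps - 1)))"
    unfolding gf_Diff[OF words_subset(1) z] .
  \<comment> \<open>The first factor of the multiplier is the coefficient of \<open>?F\<close> in
    the linear equation, and \<open>1 - fps_X\<close> clears \<open>?z\<close>. The whole multiplier
    has constant term 1.\<close>
  then have "(?F - narayana_fps\<^sup>2) * ((1 - fps_X * tt * ?z - fps_X * (1 + tt * (narayana_fps - 1))) * (1 - fps_X) * narayana_fps) = 0"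
    using narayana_fps_quadratic gf_zeros by algebra
  then show ?thesis by (rule gf_eq_narayana_fps_sq) simp
qed

lemma gf_words_132: "gf dsc (words r132) = narayana_fps\<^sup>2"
proof -
  let ?F = "gf dsc (words r132)" and ?z = "gf dsc zeros"
  have z: "zeros \<subseteq> words r132" by (rule zeros_subset_words) (simp add: r132_def)
  have A: "gf dsc (perms r132) = narayana_fps" by (simp add: gf_perms)
  have v: "words r132 - zeros \<subseteq> valid" "words r132 - perms r132 \<subseteq> valid" using words_subset(1) by blast+
  have im: "join_down ` (perms r132 \<times> words r132) \<subseteq> valid" "join_down ` ((words r132 - perms r132) \<times> zeros) \<subseteq> valid"
    using words_132_decomp v by blast+
  have "gf dsc (words r132 - zeros) = gf dsc (join_down ` (perms r132 \<times> words r132)) + gf dsc (join_down ` ((words r132 - perms r132) \<times> zeros))"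
  proof (rule trans[OF arg_cong[where f = "gf dsc", OF words_132_decomp] gf_Un[OF im]])
    show "join_down ` (perms r132 \<times> words r132) \<inter> join_down ` ((words r132 - perms r132) \<times> zeros) = {}"
      by (rule inj_on_image_disjoint[OF inj_join_down]) (use words_subset in auto)
  qed
  also have "\<dots> = fps_X * (narayana_fps * (1 + tt * (?F - 1))) + fps_X * ((?F - narayana_fps) * (1 + tt * (?z - 1)))"
    by (simp add: gf_join words_subset Nil_mem v gf_Diff[OF words_subset(1,4)] A)
  finally have "?F - ?z = fps_X * (narayana_fps * (1 + tt * (?F - 1))) + fps_X * ((?F - narayana_fps) * (1 + tt * (?z - 1)))"
    unfolding gf_Diff[OF words_subset(1) z] .
  \<comment> \<open>Again the coefficient of \<open>?F\<close> in the linear equation, times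
    \<open>1 - fps_X\<close> to clear \<open>?z\<close>.\<close>
  then have "(?F - narayana_fps\<^sup>2) * ((1 - fps_X * tt * narayana_fps - fps_X * (1 + tt * (?z - 1))) * (1 - fps_X)) = 0"
    using narayana_fps_quadratic gf_zeros by algebra
  then show ?thesis by (rule gf_eq_narayana_fps_sq) (use gf_nth_0[OF Nil_mem(3), of dsc] in simp)
qed

lemma card_words:
  assumes "R \<in> {r213, r312, r231, r132}"
  shows "real (card {w \<in> words R. length w = Suc m \<and> dsc w = k})
    = 2 / (real m + 3) * real ((m + 3) choose (k + 2)) * real (m choose k)"
proof -
  let ?S = "{w. w \<in> words R \<and> length w = Suc m}"
  have "finite ?S" by (rule finite_words[OF words_subset(1)])
  have "gf dsc (words R) $ Suc m $ k = (\<Sum>w\<in>?S. if dsc w = k then 1 else 0)"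
    unfolding gf_def fps_nth_Abs_fps fps_sum_nth fps_X_power_nth by (rule sum.cong) auto
  also have "\<dots> = real (card (?S \<inter> {w. dsc w = k}))"
    using \<open>finite ?S\<close> by (simp add: sum.If_cases)
  also have "?S \<inter> {w. dsc w = k} = {w \<in> words R. length w = Suc m \<and> dsc w = k}" by auto
  finally have "real (card {w \<in> words R. length w = Suc m \<and> dsc w = k}) = gf dsc (words R) $ Suc m $ k" ..
  also have "gf dsc (words R) = narayana_fps\<^sup>2"
    using assms gf_words_213_312 gf_words_231 gf_words_132 by auto
  finally show ?thesis by (simp only: narayana_fps_sq_nth)
qed

section \<open>Transfer to 2-arrangements\<close>

definition rank :: "nat set \<Rightarrow> nat \<Rightarrow> nat" where
  "rank T x = card {y \<in> T. y \<le> x}"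

text \<open>This order embedding carries the encoding by 0 back to the letter -1, so neither
  descents nor patterns change.\<close>

definition neg_zero :: "nat \<Rightarrow> int" where
  "neg_zero x = (if x = 0 then -1 else int x)"

lemma strict_mono_neg_zero: "strict_mono neg_zero"
  by (auto simp: strict_mono_def neg_zero_def)

lemma bij_betw_rank:
  assumes "finite T" shows "bij_betw (rank T) T {1..card T}"
proof -
  have less: "rank T x < rank T y" if "x \<in> T" "y \<in> T" "x < y" for x y
  proof -
    have "{z \<in> T. z \<le> x} \<subseteq> {z \<in> T. z \<le> y}" "y \<in> {z \<in> T. z \<le> y}" "y \<notin> {z \<in> T. z \<le> x}"
      using that by auto
    then have "{z \<in> T. z \<le> x} \<subset> {z \<in> T. z \<le> y}" by blast
    then show ?thesis unfolding rank_def using assms by (intro psubset_card_mono) simp_all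
  qed
  have inj: "inj_on (rank T) T"
  proof (rule inj_onI)
    fix x y assume "x \<in> T" "y \<in> T" "rank T x = rank T y"
    then show "x = y" using less[of x y] less[of y x] by (cases x y rule: linorder_cases) auto
  qed
  have "rank T ` T \<subseteq> {1..card T}"
  proof
    fix z assume "z \<in> rank T ` T"
    then obtain x where x: "x \<in> T" "z = rank T x" by auto
    then have "{y \<in> T. y \<le> x} \<noteq> {}" by blast
    then have "z \<noteq> 0" unfolding x(2) rank_def using assms by simp
    moreover have "z \<le> card T" unfolding x(2) rank_def using assms by (intro card_mono) auto
    ultimately show "z \<in> {1..card T}" by simp
  qed
  moreover have "card (rank T ` T) = card {1..card T}" using inj by (simp add: card_image)
  ultimately have "rank T ` T = {1..card T}" by (intro card_subset_eq) simp_all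
  then show ?thesis using inj by (simp add: bij_betw_def)
qed

lemma map_valid_iff:
  fixes g :: "nat \<Rightarrow> nat" and n :: nat
  defines "T \<equiv> {i \<in> {1..n}. g i \<noteq> 0}"
  shows "map g [1..<n + 1] \<in> valid \<longleftrightarrow> inj_on g T \<and> (\<exists>m. g ` T = {1..m})"
proof -
  have "filter ((\<noteq>) 0) (map g [1..<n + 1]) = map g (filter (\<lambda>i. g i \<noteq> 0) [1..<n + 1])"
    by (simp add: filter_map o_def eq_commute[of 0] del: upt_Suc)
  moreover have "set (filter (\<lambda>i. g i \<noteq> 0) [1..<n + 1]) = T" by (auto simp: T_def)
  ultimately have "distinct (filter ((\<noteq>) 0) (map g [1..<n + 1])) \<longleftrightarrow> inj_on g T"
    by (simp only: distinct_map) simp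
  moreover have "set (map g [1..<n + 1]) - {0} = g ` T" by (auto simp: T_def)
  ultimately show ?thesis unfolding valid_def by simp
qed

definition marked :: "nat \<Rightarrow> (nat \<Rightarrow> nat) \<Rightarrow> (nat \<Rightarrow> int) \<Rightarrow> nat set" where
  "marked n \<pi> \<phi> = {i \<in> FIX n \<pi>. \<phi> i = -1}"

text \<open>Marked points are fixed, so the permutation maps the remaining positions T onto
  themselves. The surviving positive letters are then exactly the elements of T, and standardization
  is the rank within T.\<close>

lemma perm_form_eq:
  fixes \<phi> :: "nat \<Rightarrow> int"
  assumes "\<pi> permutes {1..n}"
  defines "T \<equiv> {1..n} - marked n \<pi> \<phi>"
  shows "\<pi> ` T = T"
    "perm_form n \<pi> \<phi> = map neg_zero (map (\<lambda>i. if i \<in> T then rank T (\<pi> i) else 0) [1..<n + 1])"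
proof -
  let ?S = "marked n \<pi> \<phi>"
  have S: "?S \<subseteq> {1..n}" "\<And>i. i \<in> ?S \<Longrightarrow> \<pi> i = i" by (auto simp: marked_def FIX_def)
  have "\<pi> ` ?S = ?S" using S(2) by force
  then show T: "\<pi> ` T = T"
    unfolding T_def image_set_diff[OF permutes_inj[OF assms(1)]] permutes_image[OF assms(1)] by simp
  define w where "w = map (\<lambda>i. if i \<in> FIX n \<pi> \<and> \<phi> i = -1 then -1 else int (\<pi> i)) [1..<n+1]"
  have w: "w = map (\<lambda>i. if i \<in> T then int (\<pi> i) else -1) [1..<n+1]"
    unfolding w_def by (rule map_cong[OF refl]) (auto simp: T_def marked_def)
  have sw: "set w \<inter> {0<..} = int ` T"
  proof -
    have "set w \<inter> {0<..} = int ` (\<pi> ` T)"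
    proof (intro equalityI subsetI)
      fix x assume "x \<in> set w \<inter> {0<..}"
      then show "x \<in> int ` (\<pi> ` T)" by (auto simp: w split: if_splits)
    next
      fix x assume "x \<in> int ` (\<pi> ` T)"
      then obtain i where i: "i \<in> T" "x = int (\<pi> i)" by auto
      then have "\<pi> i \<in> T" using T by auto
      then have "0 < x" using i by (auto simp: T_def)
      moreover have "x \<in> set w" using i by (auto simp: w T_def intro!: rev_image_eqI[of i] simp del: upt_Suc)
      ultimately show "x \<in> set w \<inter> {0<..}" by simp
    qed
    then show ?thesis unfolding T .
  qed
  have rank: "card {y \<in> set w. 0 < y \<and> y \<le> int x} = rank T x" for x
  proof -
    have "{y \<in> set w. 0 < y \<and> y \<le> int x} = (set w \<inter> {0<..}) \<inter> {..int x}" by auto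
    also have "\<dots> = int ` {y \<in> T. y \<le> x}" unfolding sw by auto
    finally show ?thesis by (simp add: card_image rank_def)
  qed
  have pos: "\<pi> i > 0 \<and> rank T (\<pi> i) > 0" if "i \<in> T" for i
  proof -
    have i: "\<pi> i \<in> T" using that T by auto
    have "rank T (\<pi> i) \<in> {1..card T}"
      using bij_betw_rank[of T] i unfolding bij_betw_def T_def by blast
    then show ?thesis using i by (auto simp: T_def)
  qed
  have "perm_form n \<pi> \<phi> = std_pos w" by (simp only: perm_form_def w_def)
  also have "\<dots> = map (\<lambda>x. if x > 0 then int (card {y \<in> set w. 0 < y \<and> y \<le> x}) else x) w"
    by (simp only: std_pos_def)
  also have "\<dots> = map (\<lambda>i. if i \<in> T then int (rank T (\<pi> i)) else -1) [1..<n+1]"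
    unfolding rank[symmetric] by (subst (2) w, subst map_map, rule map_cong[OF refl]) (use pos in auto)
  also have "\<dots> = map neg_zero (map (\<lambda>i. if i \<in> T then rank T (\<pi> i) else 0) [1..<n + 1])"
    unfolding map_map by (rule map_cong[OF refl]) (use pos in \<open>auto simp: neg_zero_def\<close>)
  finally show "perm_form n \<pi> \<phi> = map neg_zero (map (\<lambda>i. if i \<in> T then rank T (\<pi> i) else 0) [1..<n + 1])" .
qed

text \<open>Ranking makes every permutation form valid. Conversely a valid word determines T as its
  nonzero positions and a bijection of T through inverse ranks; all other positions become fixed
  points coloured -1.\<close>

lemma P2_eq: "P2 n = map neg_zero ` {w \<in> valid. length w = n}"
proof (intro equalityI subsetI)
  fix x assume "x \<in> P2 n"
  then obtain \<pi> \<phi> where x: "x = perm_form n \<pi> \<phi>" and p: "\<pi> permutes {1..n}" by (auto simp: P2_def)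
  define T where "T = {1..n} - marked n \<pi> \<phi>"
  define g where "g = (\<lambda>i. if i \<in> T then rank T (\<pi> i) else 0)"
  have T: "\<pi> ` T = T" and eq: "x = map neg_zero (map g [1..<n + 1])"
    using perm_form_eq[OF p, of \<phi>] unfolding x T_def g_def by blast+
  have "bij_betw (rank T \<circ> \<pi>) T {1..card T}"
    by (rule bij_betw_trans[OF _ bij_betw_rank]) (use T permutes_inj_on[OF p] in \<open>auto simp: bij_betw_def T_def\<close>)
  then have b: "bij_betw g T {1..card T}" by (rule bij_betw_cong[THEN iffD1, rotated]) (simp add: g_def)
  have "{i \<in> {1..n}. g i \<noteq> 0} = T"
  proof -
    have "g i \<noteq> 0" if "i \<in> T" for i using b that unfolding bij_betw_def by fastforce
    then show ?thesis by (auto simp: T_def) (auto simp: g_def T_def)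
  qed
  then have "map g [1..<n + 1] \<in> valid"
    unfolding map_valid_iff using b by (auto simp: bij_betw_def)
  then show "x \<in> map neg_zero ` {w \<in> valid. length w = n}" unfolding eq by (intro imageI) simp
next
  fix x assume "x \<in> map neg_zero ` {w \<in> valid. length w = n}"
  then obtain w where w: "x = map neg_zero w" "w \<in> valid" "length w = n" by auto
  define g where "g = (\<lambda>i. w ! (i - 1))"
  define T where "T = {i \<in> {1..n}. g i \<noteq> 0}"
  have wg: "w = map g [1..<n + 1]"
    by (rule nth_equalityI) (simp_all add: w(3) g_def del: upt_Suc)
  have fT: "finite T" by (simp add: T_def)
  obtain m where m: "inj_on g T" "g ` T = {1..m}"
    using w(2) unfolding wg map_valid_iff T_def[symmetric] by blast
  have "card T = m" using card_image[OF m(1)] m(2) by simp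
  then have bg: "bij_betw g T {1..card T}" using m by (simp add: bij_betw_def)
  define e where "e = inv_into T (rank T)"
  have be: "bij_betw e {1..card T} T" unfolding e_def by (rule bij_betw_inv_into[OF bij_betw_rank[OF fT]])
  define \<pi> where "\<pi> = (\<lambda>i. if i \<in> T then e (g i) else i)"
  have bT: "bij_betw \<pi> T T"
    by (rule bij_betw_cong[THEN iffD1, OF _ bij_betw_trans[OF bg be]]) (simp add: \<pi>_def)
  have rpi: "rank T (\<pi> i) = g i" if "i \<in> T" for i
    using that bij_betw_inv_into_right[OF bij_betw_rank[OF fT], of "g i"] bij_betwE[OF bg] by (simp add: \<pi>_def e_def)
  have "\<pi> permutes T"
    by (rule bij_imp_permutes[OF bT]) (simp add: \<pi>_def)
  then have p: "\<pi> permutes {1..n}" by (rule permutes_subset) (auto simp: T_def)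
  \<comment> \<open>Fixed points inside T must keep their positive letter, hence the colour -2; with
    this choice the marked points are exactly the complement of T.\<close>
  define \<phi> where "\<phi> = restrict (\<lambda>i. if i \<in> T then -2 else (-1::int)) (FIX n \<pi>)"
  have ph: "\<phi> \<in> FIX n \<pi> \<rightarrow>\<^sub>E {-1, -2}" by (auto simp: \<phi>_def)
  have "marked n \<pi> \<phi> = {1..n} - T" by (auto simp: marked_def \<phi>_def FIX_def \<pi>_def)
  moreover have "T \<subseteq> {1..n}" by (auto simp: T_def)
  ultimately have mT: "{1..n} - marked n \<pi> \<phi> = T" by (simp only: double_diff subset_refl)
  have "perm_form n \<pi> \<phi> = x"
    unfolding perm_form_eq(2)[OF p] mT w(1) wg
    by (intro arg_cong[where f = "map neg_zero"] map_cong[OF refl]) (use rpi in \<open>auto simp: T_def\<close>)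
  then show "x \<in> P2 n" unfolding P2_def using p ph by blast
qed

lemma red_eq_iff:
  "red [a, b, c] = [2, 1, 3] \<longleftrightarrow> r213 a b c" "red [a, b, c] = [3, 1, 2] \<longleftrightarrow> r312 a b c"
  "red [a, b, c] = [2, 3, 1] \<longleftrightarrow> r231 a b c" "red [a, b, c] = [1, 3, 2] \<longleftrightarrow> r132 a b c"
proof -
  have ins: "{y \<in> insert x A. y \<le> z} = (if x \<le> z then insert x {y \<in> A. y \<le> z} else {y \<in> A. y \<le> z})"
    for x z :: int and A by auto
  show "red [a, b, c] = [2, 1, 3] \<longleftrightarrow> r213 a b c" "red [a, b, c] = [3, 1, 2] \<longleftrightarrow> r312 a b c"
    "red [a, b, c] = [2, 3, 1] \<longleftrightarrow> r231 a b c" "red [a, b, c] = [1, 3, 2] \<longleftrightarrow> r132 a b c"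
    unfolding red_def list.set ins r_defs
    by (cases a b rule: linorder_cases; cases b c rule: linorder_cases; cases a c rule: linorder_cases;
        simp add: card_insert_if)+
qed

lemma avoids_iff_av:
  assumes "\<And>a b c. red [a, b, c] = \<sigma> \<longleftrightarrow> R a b c"
  shows "avoids w \<sigma> \<longleftrightarrow> av R w"
  unfolding avoids_def av_iff_nth assms by (simp only: not_ex de_Morgan_conj imp_conv_disj)

lemma avoids_iff:
  "avoids (map neg_zero w) [2, 1, 3] \<longleftrightarrow> av r213 w" "avoids (map neg_zero w) [3, 1, 2] \<longleftrightarrow> av r312 w"
  "avoids (map neg_zero w) [2, 3, 1] \<longleftrightarrow> av r231 w" "avoids (map neg_zero w) [1, 3, 2] \<longleftrightarrow> av r132 w"
  unfolding av_map_strict_mono[OF strict_mono_neg_zero, symmetric]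
  by (rule avoids_iff_av, rule red_eq_iff)+

lemma card_P2_avoid:
  assumes "\<And>w. avoids (map neg_zero w) \<sigma> \<longleftrightarrow> av R w"
  shows "card {w \<in> P2_avoid n \<sigma>. des w = k} = card {w \<in> words R. length w = n \<and> dsc w = k}"
proof -
  have "{w \<in> P2_avoid n \<sigma>. des w = k} = map neg_zero ` {w \<in> words R. length w = n \<and> dsc w = k}"
    unfolding P2_avoid_def P2_eq des_def card_descents
    using assms by (auto simp: words_def dsc_map[OF strict_mono_neg_zero])
  moreover have "inj neg_zero" by (rule strict_mono_imp_inj_on[OF strict_mono_neg_zero])
  ultimately show ?thesis by (simp add: card_image inj_on_subset[OF inj_mapI])
qed

theorem theorem4p2:
  fixes \<sigma> :: "int list" and n k :: nat
  assumes "\<sigma> \<in> {[2,1,3], [3,1,2], [2,3,1], [1,3,2]}"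
    and "n \<ge> 2" and "k \<le> n - 2"
  shows "real (card {w \<in> P2_avoid (n - 1) \<sigma>. des w = k})
         = 2 / (real n + 1) * real ((n + 1) choose (k + 2)) * real ((n - 2) choose k)"
proof -
  obtain R where R: "R \<in> {r213, r312, r231, r132}" "\<And>w. avoids (map neg_zero w) \<sigma> \<longleftrightarrow> av R w"
    using assms(1) avoids_iff unfolding insert_iff by (elim disjE) (blast+)
  \<comment> \<open>The words have length n - 1 = \<open>Suc m\<close>, the index at which the
    coefficient formula is stated.\<close>
  define m where "m = n - 2"
  have "n = m + 2" using assms(2) by (simp add: m_def)
  then show ?thesis using card_words[OF R(1), of m k] by (simp add: card_P2_avoid[OF R(2)] eval_nat_numeral)
qed

end
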